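(* Let $n\ge 1$, let $G$ be an abelian subgroup of $GL(n,\mathbb{C})$, let $u\in\mathbb{C}^n$ and let $m\ge 0$ be an integer. The following are equivalent: (i) $G(u)$ is regular with order $m$; (ii) for every $v\in U_u$, $G(v)$ is regular with order $m$; (iii) $\dim(\overline{\mathrm{g}_u})=m$ over $\mathbb{R}$.
   Context: $G(u)=\{Au: A\in G\}$ is the orbit of $u$; $E(u)$ is the complex linear span of $G(u)$ and $r(u)=\dim_{\mathbb C}E(u)$. Bars denote closure. Regularity: an orbit $\gamma$ is regular with order $m$ if for every $v\in\gamma$ there is an open set $O$ of $\mathbb{C}^n$ containing $v$ such that $\overline{\gamma}\cap O$ is a manifold of dimension $m$ over $\mathbb{R}$. Normal form: $\mathbb{T}_m(\mathbb{C})$ is the set of lower triangular $m\times m$ complex matrices all of whose diagonal entries are equal. For $r\ge1$ and $\eta=(n_1,\dots,n_r)$ with $n_i\ge 1$ and $\sum n_i=n$, $\mathcal{K}_{\eta,r}(\mathbb{C})=\mathbb{T}_{n_1}(\mathbb{C})\oplus\dots\oplus\mathbb{T}_{n_r}(\mathbb{C})$ (block diagonal matrices) and $\mathcal{K}^*_{\eta,r}(\mathbb{C})=\mathcal{K}_{\eta,r}(\mathbb{C})\cap GL(n,\mathbb{C})$. For every abelian subgroup $G$ of $GL(n,\mathbb{C})$ there are $r,\eta$ and $P\in GL(n,\mathbb{C})$ with $P^{-1}GP\subset\mathcal{K}^*_{\eta,r}(\mathbb{C})$ (known); fix such a choice. Then $\mathrm{g}=\exp^{-1}(G)\cap\left[P\,\mathcal{K}_{\eta,r}(\mathbb{C})\,P^{-1}\right]$,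 where $\exp$ is the matrix exponential, and $\mathrm{g}_u=\{Bu: B\in\mathrm{g}\}$, which is an additive subgroup of $\mathbb{C}^n$. Dimension: for a closed additive subgroup $F$ of $\mathbb{C}^n$, $\dim(F)$ is the largest dimension of a real vector subspace of $\mathbb{C}^n$ contained in $F$. The set $U_u$: it is the $G$-invariant dense open subset of $E(u)$ containing $u$ such that $E(v)=E(u)$ for all $v\in U_u$ and $E(u)\setminus U_u$ is a union of at most $r(u)$ $G$-invariant complex subspaces of dimension $r(u)-1$; these properties determine it as $U_u=\{v\in E(u): E(v)=E(u)\}$. Concretely, choosing a basis of $E(u)$ in which the restriction of $G$ to $E(u)$ is a subgroup of some $\mathcal{K}^*_{(n'_1,\dots,n'_{r'}),r'}(\mathbb{C})$, $U_u$ corresponds to $\prod_{k=1}^{r'}\mathbb{C}^*\times\mathbb{C}^{n'_k-1}$. *)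

theory Defs
  imports "HOL-Analysis.Analysis"
begin

text \<open>
  The space of complex column vectors with n entries is \<open>complex ^ 'n\<close> with \<open>n = CARD('n)\<close>.
  The linear order on the index type only serves to speak of lower triangular and block diagonal
  matrices.  Matrices are multiplied by \<open>**\<close>; the type-class operation \<open>*\<close> on
  \<open>complex ^ 'n ^ 'n\<close> is the entrywise product.
\<close>

definition abelian_subgroup_GL :: "(complex ^ 'n ^ 'n) set \<Rightarrow> bool" where
  "abelian_subgroup_GL G \<longleftrightarrow>
     (\<forall>A\<in>G. invertible A) \<and> mat 1 \<in> G \<and>
     (\<forall>A\<in>G. \<forall>B\<in>G. A ** B \<in> G) \<and> (\<forall>A\<in>G. matrix_inv A \<in> G) \<and>
     (\<forall>A\<in>G. \<forall>B\<in>G. A ** B = B ** A)"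

definition orbit :: "(complex ^ 'n ^ 'n) set \<Rightarrow> complex ^ 'n \<Rightarrow> (complex ^ 'n) set" where
  "orbit G u = {A *v u |A. A \<in> G}"

text \<open>\<open>vec.span\<close> is the complex span (\<open>span\<close> would be the real one).\<close>

definition E_space :: "(complex ^ 'n ^ 'n) set \<Rightarrow> complex ^ 'n \<Rightarrow> (complex ^ 'n) set" where
  "E_space G u = vec.span (orbit G u)"

definition U_set :: "(complex ^ 'n ^ 'n) set \<Rightarrow> complex ^ 'n \<Rightarrow> (complex ^ 'n) set" where
  "U_set G u = {v \<in> E_space G u. E_space G v = E_space G u}"

text \<open>
  Topological manifolds without boundary, with the subspace topology.  The Hausdorff and second
  countability axioms hold automatically for subsets of a Euclidean space.
\<close>

definition manifold_of_dim :: "nat \<Rightarrow> 'a::euclidean_space set \<Rightarrow> bool" where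
  "manifold_of_dim m S \<longleftrightarrow>
     (\<forall>x\<in>S. \<exists>W V. openin (top_of_set S) W \<and> x \<in> W \<and> openin (Euclidean_space m) V \<and>
        top_of_set W homeomorphic_space subtopology (Euclidean_space m) V)"

definition regular_with_order :: "nat \<Rightarrow> (complex ^ 'n) set \<Rightarrow> bool" where
  "regular_with_order m \<gamma> \<longleftrightarrow>
     (\<forall>v\<in>\<gamma>. \<exists>Q. open Q \<and> v \<in> Q \<and> manifold_of_dim m (closure \<gamma> \<inter> Q))"

text \<open>
  \<open>pos i\<close> is the zero-based position of the index \<open>i\<close>, and \<open>block \<eta> i\<close> is the (zero-based) number
  of the block containing it when the positions are cut into consecutive blocks of the sizes
  listed in \<open>\<eta>\<close>.
\<close>

definition pos :: "'n::{finite,linorder} \<Rightarrow> nat" where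
  "pos i = card {j. j < i}"

definition block :: "nat list \<Rightarrow> 'n::{finite,linorder} \<Rightarrow> nat" where
  "block \<eta> i = (LEAST k. pos i < sum_list (take (Suc k) \<eta>))"

definition block_sizes :: "'n::finite itself \<Rightarrow> nat list \<Rightarrow> bool" where
  "block_sizes _ \<eta> \<longleftrightarrow> (\<forall>k\<in>set \<eta>. 1 \<le> k) \<and> sum_list \<eta> = CARD('n)"

text \<open>Block diagonal; each diagonal block lower triangular with constant diagonal.\<close>

definition K_alg :: "nat list \<Rightarrow> (complex ^ 'n::{finite,linorder} ^ 'n::{finite,linorder}) set" where
  "K_alg \<eta> = {A. (\<forall>i j. block \<eta> i \<noteq> block \<eta> j \<longrightarrow> A $ i $ j = 0) \<and>
                 (\<forall>i j. block \<eta> i = block \<eta> j \<and> i < j \<longrightarrow> A $ i $ j = 0) \<and>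
                 (\<forall>i j. block \<eta> i = block \<eta> j \<longrightarrow> A $ i $ i = A $ j $ j)}"

definition K_star :: "nat list \<Rightarrow> (complex ^ 'n::{finite,linorder} ^ 'n::{finite,linorder}) set" where
  "K_star \<eta> = K_alg \<eta> \<inter> {A. invertible A}"

definition normal_form ::
  "(complex ^ 'n::{finite,linorder} ^ 'n::{finite,linorder}) set \<Rightarrow> nat list
     \<Rightarrow> complex ^ 'n::{finite,linorder} ^ 'n::{finite,linorder} \<Rightarrow> bool" where
  "normal_form G \<eta> P \<longleftrightarrow>
     block_sizes TYPE('n) \<eta> \<and> invertible P \<and>
     (\<lambda>A. matrix_inv P ** A ** P) ` G \<subseteq> K_star \<eta>"

definition matrix_power :: "complex ^ 'n ^ 'n \<Rightarrow> nat \<Rightarrow> complex ^ 'n ^ 'n" where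
  "matrix_power A k = ((\<lambda>B. A ** B) ^^ k) (mat 1)"

definition matrix_exp :: "complex ^ 'n ^ 'n \<Rightarrow> complex ^ 'n ^ 'n" where
  "matrix_exp A = (\<Sum>k. (1 / fact k) *\<^sub>R matrix_power A k)"

definition g_set ::
  "(complex ^ 'n::{finite,linorder} ^ 'n::{finite,linorder}) set \<Rightarrow> nat list
     \<Rightarrow> complex ^ 'n::{finite,linorder} ^ 'n::{finite,linorder}
     \<Rightarrow> (complex ^ 'n::{finite,linorder} ^ 'n::{finite,linorder}) set" where
  "g_set G \<eta> P = {B. matrix_exp B \<in> G} \<inter> (\<lambda>A. P ** A ** matrix_inv P) ` K_alg \<eta>"

definition g_at ::
  "(complex ^ 'n::{finite,linorder} ^ 'n::{finite,linorder}) set \<Rightarrow> nat list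
     \<Rightarrow> complex ^ 'n::{finite,linorder} ^ 'n::{finite,linorder}
     \<Rightarrow> complex ^ 'n::{finite,linorder} \<Rightarrow> (complex ^ 'n::{finite,linorder}) set" where
  "g_at G \<eta> P u = {B *v u |B. B \<in> g_set G \<eta> P}"

text \<open>\<open>subspace\<close> and \<open>dim\<close> are the real notions.\<close>

definition closed_subgroup_dim :: "'a::euclidean_space set \<Rightarrow> nat" where
  "closed_subgroup_dim F = Max {dim V |V. subspace V \<and> V \<subseteq> F}"

end

theory Submission
  imports Defs "HOL-Homology.Invariance_of_Domain"
begin

text \<open>
  A vector \<open>v\<close> of \<open>E_space G u\<close> has the form \<open>B u\<close> with a matrix \<open>B\<close> that commutes with \<open>G\<close>.  If
  moreover \<open>E_space G v = E_space G u\<close>, then also \<open>u = C v\<close> with such a \<open>C\<close>, and \<open>B\<close> and \<open>C\<close>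
  restrict to mutually inverse bijections between the closures of the two orbits; so the orbits are
  regular with the same orders (\<open>regular_orbit_iff_U_set\<close>).

  For the comparison with the logarithms, regularity only has to be tested near \<open>u\<close>, by
  homogeneity (\<open>regular_orbit_iff_local\<close>).  Let \<open>K = P (K_alg \<eta>) P\<^sup>-\<^sup>1\<close>.  The set \<open>log_\<Gamma>\<close> of those
  elements of \<open>K\<close> whose exponential lies in \<open>G\<close> is an additive group inside a commutative algebra \<open>\<C>\<close>, and
  \<open>exp\<close> maps it onto \<open>G\<close>; this rests on the fact that a nilpotent element can be recovered from its
  exponential (\<open>nilpotent_log\<close>, \<open>commutes_if_commutes_exp_nilpotent\<close>).  The rule
  \<open>X u \<mapsto> exp(X) u\<close> for \<open>X\<close> in \<open>\<C>\<close> defines a map \<open>chart\<close> of the vector space \<open>W = \<C> u\<close> into itself which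
  satisfies \<open>chart (x + y) = exp(X) (chart y)\<close> for \<open>x = X u\<close>.  Its fibre over \<open>u\<close> is discrete
  (\<open>stabilizer_discrete\<close>): if \<open>exp(X) u = u\<close>, then on each block where \<open>u\<close> has a component the
  eigenvalue of \<open>X\<close> is a multiple of \<open>2 \<pi> i\<close> and the nilpotent part of \<open>X\<close> kills the component.  The
  fibre is also contained in \<open>log_\<Gamma> u\<close> (\<open>stabilizer\<close>).  Hence \<open>chart\<close> is injective near \<open>0\<close>, it is a
  homeomorphism of a neighbourhood of \<open>0\<close> in \<open>W\<close> onto a neighbourhood of \<open>u\<close> in \<open>W\<close> by invariance of
  domain, and the preimage of the orbit is exactly \<open>log_\<Gamma> u\<close>, that is, \<open>g_at G \<eta> P u\<close>.  Thus the
  closure of the orbit looks near \<open>u\<close> like the closure of the group \<open>g_at G \<eta> P u\<close> near \<open>0\<close>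
  (\<open>locally_manifold\<close>).

  A closed subgroup \<open>F\<close> of a Euclidean space coincides near \<open>0\<close> with the largest
  real subspace that it contains (\<open>closed_subgroup_locally_linear\<close>), whose dimension is
  \<open>closed_subgroup_dim F\<close>.  So the orbit is always regular, with the order \<open>closed_subgroup_dim\<close> of
  the closure of \<open>g_at G \<eta> P u\<close>, and invariance of dimension shows that it has no other order
  (\<open>manifold_dim_unique\<close>).
\<close>

section \<open>The Banach algebra of endomorphisms\<close>

text \<open>
  A copy of the type of bounded operators.  With composition as multiplication it is an instance
  of \<^class>\<open>real_normed_algebra_1\<close> and \<^class>\<open>banach\<close>, so that the power series of \<open>exp\<close> and its
  functional equation for commuting arguments apply to operators.
\<close>
typedef (overloaded) 'a endo = "UNIV :: ('a::real_normed_vector \<Rightarrow>\<^sub>L 'a) set" ..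

setup_lifting type_definition_endo

lift_definition endo_apply :: "'a::real_normed_vector endo \<Rightarrow> 'a \<Rightarrow> 'a" (infixr "\<cdot>" 75)
  is blinfun_apply .

lemma endo_eqI: "(\<And>x. S \<cdot> x = T \<cdot> x) \<Longrightarrow> S = T"
  by transfer (rule blinfun_eqI)

instantiation endo :: ("{banach,perfect_space}") real_normed_algebra_1
begin

lift_definition zero_endo :: "'a endo" is 0 .
lift_definition one_endo :: "'a endo" is id_blinfun .
lift_definition plus_endo :: "'a endo \<Rightarrow> 'a endo \<Rightarrow> 'a endo" is "(+)" .
lift_definition minus_endo :: "'a endo \<Rightarrow> 'a endo \<Rightarrow> 'a endo" is "(-)" .
lift_definition uminus_endo :: "'a endo \<Rightarrow> 'a endo" is uminus .
lift_definition scaleR_endo :: "real \<Rightarrow> 'a endo \<Rightarrow> 'a endo" is "(*\<^sub>R)" .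
lift_definition times_endo :: "'a endo \<Rightarrow> 'a endo \<Rightarrow> 'a endo" is "(o\<^sub>L)" .
lift_definition norm_endo :: "'a endo \<Rightarrow> real" is norm .
lift_definition sgn_endo :: "'a endo \<Rightarrow> 'a endo" is sgn .
lift_definition dist_endo :: "'a endo \<Rightarrow> 'a endo \<Rightarrow> real" is dist .

definition uniformity_endo :: "('a endo \<times> 'a endo) filter" where
  "uniformity_endo = (INF e\<in>{0 <..}. principal {(x, y). dist x y < e})"

definition open_endo :: "'a endo set \<Rightarrow> bool" where
  "open_endo U \<longleftrightarrow> (\<forall>x\<in>U. eventually (\<lambda>(x', y). x' = x \<longrightarrow> y \<in> U) uniformity)"

instance
proof (standard; (unfold uniformity_endo_def open_endo_def)?)
  fix R S T :: "'a endo" and a b :: real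
  show "R + S + T = R + (S + T)" "R + S = S + R" "0 + R = R" "- R + R = 0" "R - S = R + - S"
    "a *\<^sub>R (R + S) = a *\<^sub>R R + a *\<^sub>R S" "(a + b) *\<^sub>R R = a *\<^sub>R R + b *\<^sub>R R"
    "a *\<^sub>R b *\<^sub>R R = (a * b) *\<^sub>R R" "1 *\<^sub>R R = R"
    by (transfer; simp add: algebra_simps)+
  show "R * S * T = R * (S * T)" "1 * R = R" "R * 1 = R" "(R + S) * T = R * T + S * T"
    "R * (S + T) = R * S + R * T" "a *\<^sub>R R * S = a *\<^sub>R (R * S)" "R * a *\<^sub>R S = a *\<^sub>R (R * S)"
    by (transfer; auto intro!: blinfun_eqI simp: blinfun.bilinear_simps)+
  show "norm (R * S) \<le> norm R * norm S" by transfer (rule norm_blinfun_compose)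
  show "norm (1::'a endo) = 1" by transfer (rule norm_blinfun_id)
  show "0 \<noteq> (1::'a endo)" by transfer (metis norm_blinfun_id norm_zero zero_neq_one)
  show "dist R S = norm (R - S)" by transfer (rule dist_norm)
  show "sgn R = inverse (norm R) *\<^sub>R R" by transfer (rule sgn_div_norm)
  show "(norm R = 0) = (R = 0)" "norm (R + S) \<le> norm R + norm S"
    "norm (a *\<^sub>R R) = \<bar>a\<bar> * norm R"
    by (transfer; simp add: norm_triangle_ineq)+
qed (rule refl)+

end

instance endo :: ("{banach,perfect_space}") banach
proof
  fix X :: "nat \<Rightarrow> 'a endo"
  assume "Cauchy X"
  have d: "dist (Rep_endo S) (Rep_endo T) = dist S T" for S T :: "'a endo"
    by transfer simp
  have "Cauchy (\<lambda>n. Rep_endo (X n))"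
    using \<open>Cauchy X\<close> unfolding Cauchy_def d .
  then obtain L where "(\<lambda>n. Rep_endo (X n)) \<longlonglongrightarrow> L"
    using Cauchy_convergent convergent_def by blast
  then have "(\<lambda>n. Rep_endo (X n)) \<longlonglongrightarrow> Rep_endo (Abs_endo L)"
    by (simp add: Abs_endo_inverse)
  then have "X \<longlonglongrightarrow> Abs_endo L"
    unfolding lim_sequentially d .
  then show "convergent X" by (auto simp: convergent_def)
qed

lemma endo_apply_simps [simp]:
  fixes S T :: "'a::{banach,perfect_space} endo"
  shows "(S * T) \<cdot> x = S \<cdot> T \<cdot> x" "(1::'a endo) \<cdot> x = x" "(0::'a endo) \<cdot> x = 0"
    "(S + T) \<cdot> x = S \<cdot> x + T \<cdot> x" "(S - T) \<cdot> x = S \<cdot> x - T \<cdot> x" "(- T) \<cdot> x = - (T \<cdot> x)"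
    "(c *\<^sub>R T) \<cdot> x = c *\<^sub>R (T \<cdot> x)"
  by (transfer; simp add: blinfun.bilinear_simps)+

lemma bounded_bilinear_endo_apply:
  "bounded_bilinear ((\<cdot>) :: 'a::{banach,perfect_space} endo \<Rightarrow> 'a \<Rightarrow> 'a)"
proof
  fix S T :: "'a endo" and x y :: 'a and r :: real
  show "(S + T) \<cdot> x = S \<cdot> x + T \<cdot> x" "(r *\<^sub>R S) \<cdot> x = r *\<^sub>R (S \<cdot> x)" by simp_all
  show "S \<cdot> (x + y) = S \<cdot> x + S \<cdot> y" "S \<cdot> r *\<^sub>R x = r *\<^sub>R (S \<cdot> x)"
    by (transfer; simp add: blinfun.bilinear_simps)+
  have "norm (S \<cdot> x) \<le> norm S * norm x * 1" for S :: "'a endo" and x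
    by transfer (simp add: norm_blinfun)
  then show "\<exists>K. \<forall>S x. norm ((S :: 'a endo) \<cdot> x) \<le> norm S * norm x * K" by blast
qed

interpretation endo: bounded_bilinear "(\<cdot>) :: 'a::{banach,perfect_space} endo \<Rightarrow> 'a \<Rightarrow> 'a"
  by (rule bounded_bilinear_endo_apply)

lemma norm_endo_apply_le: "norm (T \<cdot> x) \<le> norm T * norm x"
  for T :: "'a::{banach,perfect_space} endo"
  by transfer (rule norm_blinfun)

section \<open>Closed subalgebras and the exponential\<close>

text \<open>
  Closedness makes a subalgebra stable under \<open>exp\<close> and under the remainder series below.
\<close>
definition closed_subalgebra :: "'b::real_normed_algebra_1 set \<Rightarrow> bool" where
  "closed_subalgebra S \<longleftrightarrow> subspace S \<and> closed S \<and> 1 \<in> S \<and> (\<forall>a\<in>S. \<forall>b\<in>S. a * b \<in> S)"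

definition centralizer :: "'b::real_normed_algebra_1 set \<Rightarrow> 'b set" where
  "centralizer B = {X. \<forall>Y\<in>B. X * Y = Y * X}"

lemma centralizerI: "(\<And>Y. Y \<in> B \<Longrightarrow> X * Y = Y * X) \<Longrightarrow> X \<in> centralizer B"
  and centralizerD: "X \<in> centralizer B \<Longrightarrow> Y \<in> B \<Longrightarrow> X * Y = Y * X"
  by (auto simp: centralizer_def)

lemma closed_subalgebra_Int:
  "closed_subalgebra S \<Longrightarrow> closed_subalgebra T \<Longrightarrow> closed_subalgebra (S \<inter> T)"
  by (auto simp: closed_subalgebra_def subspace_inter)

lemma closed_subalgebra_centralizer: "closed_subalgebra (centralizer B)"
proof -
  have "centralizer B = (\<Inter>Y\<in>B. {X. X * Y = Y * X})" by (auto simp: centralizer_def)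
  moreover have "closed {X. X * Y = Y * X}" for Y :: 'a
    by (intro closed_Collect_eq continuous_intros)
  ultimately have "closed (centralizer B)" by auto
  moreover have "subspace (centralizer B)"
    by (auto simp: subspace_def centralizer_def algebra_simps)
  moreover have "X * X' \<in> centralizer B" if "X \<in> centralizer B" "X' \<in> centralizer B" for X X'
  proof (rule centralizerI)
    fix Y assume "Y \<in> B"
    then have 1: "X * Y = Y * X" and 2: "X' * Y = Y * X'"
      using that by (simp_all add: centralizer_def)
    have "X * X' * Y = X * Y * X'" by (simp only: 2 mult.assoc)
    then show "X * X' * Y = Y * (X * X')" by (simp only: 1 mult.assoc)
  qed
  ultimately show ?thesis by (auto simp: closed_subalgebra_def centralizer_def)
qed

context
  fixes S :: "'b::{real_normed_algebra_1,banach} set"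
  assumes S: "closed_subalgebra S"
begin

lemma closed_subalgebra_simps:
  "0 \<in> S" "1 \<in> S" "x \<in> S \<Longrightarrow> y \<in> S \<Longrightarrow> x + y \<in> S" "x \<in> S \<Longrightarrow> y \<in> S \<Longrightarrow> x - y \<in> S"
  "x \<in> S \<Longrightarrow> - x \<in> S" "x \<in> S \<Longrightarrow> c *\<^sub>R x \<in> S" "x \<in> S \<Longrightarrow> y \<in> S \<Longrightarrow> x * y \<in> S"
  using S by (auto simp: closed_subalgebra_def subspace_def subspace_diff subspace_neg)

lemma closed_subalgebra_power: "x \<in> S \<Longrightarrow> x ^ n \<in> S"
  by (induction n) (auto simp: closed_subalgebra_simps)

lemma closed_subalgebra_suminf:
  assumes "\<And>n::nat. f n \<in> S" "summable f"
  shows "suminf f \<in> S"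
proof (rule Lim_in_closed_set)
  show "closed S" using S by (simp add: closed_subalgebra_def)
  show "(\<lambda>n. sum f {..<n}) \<longlonglongrightarrow> suminf f" using assms(2) by (rule summable_LIMSEQ)
  have "sum f {..<n} \<in> S" for n
    using S assms(1) by (auto simp: closed_subalgebra_def intro: subspace_sum)
  then show "\<forall>\<^sub>F n in sequentially. sum f {..<n} \<in> S" by simp
qed simp

lemma closed_subalgebra_exp: "x \<in> S \<Longrightarrow> exp x \<in> S"
  unfolding exp_def
  by (intro closed_subalgebra_suminf closed_subalgebra_simps closed_subalgebra_power
      summable_exp_generic)

end

text \<open>
  The remainder is the power series \<open>\<Sum>n. x ^ n / (n + 2)!\<close>, so it lies in every closed subalgebra
  that contains \<open>x\<close>.  In this way membership and commutation statements about logarithms are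
  reduced to algebra.
\<close>
lemma exp_second_order_remainder:
  fixes x :: "'b::{real_normed_algebra_1,banach}"
  obtains \<psi> where "exp x = 1 + x + x * x * \<psi>" "\<psi> * x = x * \<psi>"
    "\<And>S. closed_subalgebra S \<Longrightarrow> x \<in> S \<Longrightarrow> \<psi> \<in> S"
proof -
  define t where "t n = x ^ n /\<^sub>R fact (n + 2)" for n
  have sm: "summable t"
  proof (rule summable_comparison_test)
    show "summable (\<lambda>n. norm x ^ n /\<^sub>R fact n)" by (rule summable_exp_generic)
    have "norm (t n) \<le> norm x ^ n /\<^sub>R fact n" for n
    proof -
      have "inverse (fact (n + 2)) \<le> (inverse (fact n) :: real)"
        by (intro le_imp_inverse_le fact_mono) auto
      then show ?thesis
        unfolding t_def norm_scaleR real_scaleR_def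
        by (intro mult_mono) (auto simp: norm_power_ineq)
    qed
    then show "\<exists>N. \<forall>n\<ge>N. norm (t n) \<le> norm x ^ n /\<^sub>R fact n" by blast
  qed
  have e: "x ^ (n + 2) /\<^sub>R fact (n + 2) = x * x * t n" for n
    by (simp add: t_def mult.assoc)
  have "exp x = suminf (\<lambda>n. x ^ (n + 2) /\<^sub>R fact (n + 2)) + (\<Sum>n<2. x ^ n /\<^sub>R fact n)"
    unfolding exp_def by (rule suminf_split_initial_segment) (rule summable_exp_generic)
  also have "(\<Sum>n<2. x ^ n /\<^sub>R fact n) = 1 + x" by (simp add: numeral_2_eq_2)
  also have "suminf (\<lambda>n. x ^ (n + 2) /\<^sub>R fact (n + 2)) = x * x * suminf t"
    unfolding e by (rule suminf_mult[OF sm])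
  finally have "exp x = 1 + x + x * x * suminf t" by (simp add: algebra_simps)
  moreover have mem: "suminf t \<in> S" if "closed_subalgebra S" "x \<in> S" for S
    unfolding t_def
    by (rule closed_subalgebra_suminf[OF that(1)])
       (use that sm in \<open>auto simp: closed_subalgebra_simps closed_subalgebra_power t_def[abs_def]\<close>)
  moreover have "suminf t * x = x * suminf t"
    using mem[OF closed_subalgebra_centralizer[of "{x}"]] by (simp add: centralizer_def)
  ultimately show ?thesis using that by blast
qed

lemma norm_exp_minus_1_le:
  fixes x :: "'b::{real_normed_algebra_1,banach}"
  shows "norm (exp x - 1) \<le> exp (norm x) - 1"
proof -
  have s: "summable (\<lambda>n. norm x ^ Suc n /\<^sub>R fact (Suc n))"
    using summable_exp_generic[of "norm x"] by (subst summable_Suc_iff)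
  have le: "norm (x ^ Suc n /\<^sub>R fact (Suc n)) \<le> norm x ^ Suc n /\<^sub>R fact (Suc n)" for n
    unfolding norm_scaleR real_scaleR_def
    by (intro mult_mono norm_power_ineq) auto
  have s': "summable (\<lambda>n. norm (x ^ Suc n /\<^sub>R fact (Suc n)))"
    using summable_norm_exp[of x] by (subst summable_Suc_iff)
  have "exp x - 1 = suminf (\<lambda>n. x ^ Suc n /\<^sub>R fact (Suc n))"
    unfolding exp_def using suminf_split_head[OF summable_exp_generic[of x]] by simp
  also have "norm \<dots> \<le> suminf (\<lambda>n. norm (x ^ Suc n /\<^sub>R fact (Suc n)))"
    by (rule summable_norm[OF s'])
  also have "\<dots> \<le> suminf (\<lambda>n. norm x ^ Suc n /\<^sub>R fact (Suc n))"
    by (rule suminf_le[OF le s' s])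
  also have "\<dots> = exp (norm x) - 1"
    unfolding exp_def using suminf_split_head[OF summable_exp_generic[of "norm x"]] by simp
  finally show ?thesis .
qed

section \<open>Nilpotent elements and their exponentials\<close>

definition nilpotent :: "'b::ring_1 \<Rightarrow> bool" where
  "nilpotent x \<longleftrightarrow> (\<exists>n. x ^ n = 0)"

lemma nilpotent_mult_commuting:
  assumes "nilpotent x" "x * y = y * x"
  shows "nilpotent (x * y)"
proof -
  have "(x * y) ^ n = y ^ n * x ^ n" for n
  proof (induction n)
    case (Suc n)
    have "(x * y) ^ Suc n = x * y * (y ^ n * x ^ n)" by (simp add: Suc)
    also have "\<dots> = y * (x * y ^ n) * x ^ n" by (simp only: assms(2) mult.assoc)
    also have "x * y ^ n = y ^ n * x" by (rule power_commuting_commutes[symmetric, OF assms(2)[symmetric]])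
    finally show ?case by (simp add: mult.assoc)
  qed simp
  with assms(1) show ?thesis unfolding nilpotent_def by (metis mult_zero_right)
qed

lemma nilpotent_fixed_point_zero:
  fixes Z :: "'a::{banach,perfect_space} endo"
  assumes "nilpotent Z" "Z \<cdot> w = w"
  shows "w = 0"
proof -
  have "Z ^ n \<cdot> w = w" for n by (induction n) (auto simp: assms(2))
  then show ?thesis using assms(1) unfolding nilpotent_def by (metis endo_apply_simps(3))
qed

text \<open>
  A successive approximation: if \<open>1 + M = exp(M r) (1 + Y)\<close> with \<open>Y\<close> divisible by \<open>M ^ (j + 1)\<close>,
  then splitting off the factor \<open>exp Y\<close> leaves an error divisible by \<open>Y * Y\<close>, hence by
  \<open>M ^ (j + 2)\<close>.  As \<open>M\<close> is nilpotent, the error vanishes after finitely many steps.  The logarithm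
  is produced as a multiple of \<open>M\<close>, which makes it nilpotent as soon as \<open>M\<close> commutes with \<open>r\<close>.
\<close>
lemma nilpotent_log_commutative:
  fixes M :: "'b::{real_normed_algebra_1,banach}"
  assumes S: "closed_subalgebra S" and comm: "\<And>a b. a \<in> S \<Longrightarrow> b \<in> S \<Longrightarrow> a * b = b * a"
    and M: "M \<in> S" "nilpotent M"
  obtains r where "r \<in> S" "exp (M * r) = 1 + M"
proof -
  note [simp] = closed_subalgebra_simps[OF S] closed_subalgebra_power[OF S]
    closed_subalgebra_exp[OF S] M(1)
  have "\<exists>r\<in>S. \<exists>q\<in>S. 1 + M = exp (M * r) * (1 + M ^ Suc j * q)" for j
  proof (induction j)
    case 0
    show ?case by (rule bexI[of _ 0], rule bexI[of _ 1]) auto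
  next
    case (Suc j)
    then obtain r q where [simp]: "r \<in> S" "q \<in> S"
      and eq: "1 + M = exp (M * r) * (1 + M ^ Suc j * q)" by blast
    \<comment> \<open>\<open>(1 + Y) exp(- Y) = 1 + O(Y * Y)\<close>, and \<open>Y * Y\<close> is divisible by \<open>M ^ (j + 2)\<close>.\<close>
    define Y where "Y = M ^ Suc j * q"
    have [simp]: "Y \<in> S" by (simp add: Y_def)
    have "- Y \<in> S" by simp
    then obtain \<psi> where \<psi>: "exp (- Y) = 1 + (- Y) + (- Y) * (- Y) * \<psi>" and [simp]: "\<psi> \<in> S"
      using exp_second_order_remainder[of "- Y"] S by blast
    have 1: "exp Y * (exp (- Y) * (1 + Y)) = 1 + Y"
      by (simp add: exp_minus_inverse flip: mult.assoc)
    have 2: "exp (- Y) * (1 + Y) = 1 + Y * Y * (\<psi> * (1 + Y) - 1)"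
      unfolding \<psi> by (simp add: algebra_simps)
    have p: "M ^ Suc j * M ^ Suc j = M ^ Suc (Suc j) * M ^ j"
      by (simp flip: power_add del: power_Suc)
    have "Y * Y = M ^ Suc j * (q * M ^ Suc j) * q" by (simp only: Y_def mult.assoc)
    also have "q * M ^ Suc j = M ^ Suc j * q" by (intro comm) simp_all
    also have "M ^ Suc j * (M ^ Suc j * q) * q = M ^ Suc (Suc j) * (M ^ j * q * q)"
      by (metis mult.assoc p)
    finally have 3: "Y * Y = M ^ Suc (Suc j) * (M ^ j * q * q)" .
    have "exp (M * r) * exp Y = exp (M * r + Y)"
      by (rule exp_add_commuting[symmetric], rule comm) simp_all
    also have "M * r + Y = M * (r + M ^ j * q)" by (simp add: Y_def algebra_simps)
    finally have 4: "exp (M * r) * exp Y = exp (M * (r + M ^ j * q))" .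
    have "1 + M = exp (M * r) * (1 + Y)" using eq by (simp only: Y_def)
    also have "\<dots> = exp (M * r) * exp Y * (exp (- Y) * (1 + Y))"
      by (simp only: 1 mult.assoc)
    also have "exp (- Y) * (1 + Y) = 1 + M ^ Suc (Suc j) * (M ^ j * q * q * (\<psi> * (1 + Y) - 1))"
      by (simp only: 2 3 mult.assoc)
    finally have "1 + M = exp (M * (r + M ^ j * q)) *
        (1 + M ^ Suc (Suc j) * (M ^ j * q * q * (\<psi> * (1 + Y) - 1)))"
      by (simp only: 4)
    moreover have "M ^ j * q * q * (\<psi> * (1 + Y) - 1) \<in> S" by simp
    moreover have "r + M ^ j * q \<in> S" by simp
    ultimately show ?case by blast
  qed
  moreover from M(2) obtain n where "M ^ n = 0" by (auto simp: nilpotent_def)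
  ultimately obtain r q where "r \<in> S" "1 + M = exp (M * r) * (1 + M ^ Suc n * q)" by blast
  with \<open>M ^ n = 0\<close> show ?thesis by (intro that[of r]) auto
qed

text \<open>
  The closed subalgebra need not be commutative: its intersection with the bicommutant of \<open>M\<close> is,
  and the logarithm can be found there.  Lying in the bicommutant, it commutes with everything that
  commutes with \<open>M\<close>.
\<close>
lemma nilpotent_log:
  fixes M :: "'b::{real_normed_algebra_1,banach}"
  assumes S: "closed_subalgebra S" and M: "M \<in> S" "nilpotent M"
  obtains r where "r \<in> S" "r \<in> centralizer (centralizer {M})" "exp (M * r) = 1 + M"
proof -
  let ?Z = "centralizer (centralizer {M})"
  have Z: "closed_subalgebra (S \<inter> ?Z)"
    by (intro closed_subalgebra_Int S closed_subalgebra_centralizer)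
  have comm: "a * b = b * a" if "a \<in> S \<inter> ?Z" "b \<in> S \<inter> ?Z" for a b
  proof -
    have "M \<in> centralizer {M}" by (simp add: centralizer_def)
    with that(2) have "b * M = M * b" by (metis IntE centralizerD)
    then have "b \<in> centralizer {M}" by (simp add: centralizer_def)
    with that(1) show ?thesis by (metis IntE centralizerD)
  qed
  have M': "M \<in> S \<inter> ?Z"
    using M(1) by (simp add: centralizer_def)
  obtain r where "r \<in> S \<inter> ?Z" "exp (M * r) = 1 + M"
    by (rule nilpotent_log_commutative[OF Z comm M' M(2)])
  then show ?thesis using that by blast
qed

text \<open>
  Since \<open>exp N - 1 = N (1 + N \<psi>)\<close>, the vector \<open>N w\<close> is fixed by the nilpotent operator \<open>- N \<psi>\<close>.
\<close>
lemma nilpotent_exp_fixed_point: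
  fixes N :: "'a::{banach,perfect_space} endo"
  assumes "nilpotent N" "exp N \<cdot> w = w"
  shows "N \<cdot> w = 0"
proof -
  obtain \<psi> where \<psi>: "exp N = 1 + N + N * N * \<psi>" and c: "\<psi> * N = N * \<psi>"
    using exp_second_order_remainder[of N] by blast
  have "N * (- \<psi>) = (- \<psi>) * N" using c by simp
  then have nil: "nilpotent (N * (- \<psi>))" using nilpotent_mult_commuting assms(1) by blast
  have "N * N * \<psi> = N * \<psi> * N" by (simp add: mult.assoc c)
  then have "exp N = 1 + N + N * \<psi> * N" by (simp only: \<psi>)
  then have "w = w + N \<cdot> w + N \<cdot> \<psi> \<cdot> N \<cdot> w" using assms(2) by simp
  then have "N \<cdot> \<psi> \<cdot> N \<cdot> w = - (N \<cdot> w)" by (simp add: add.assoc add_eq_0_iff)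
  then have "(N * (- \<psi>)) \<cdot> (N \<cdot> w) = N \<cdot> w" by (simp add: endo.minus_right)
  then show ?thesis by (rule nilpotent_fixed_point_zero[OF nil])
qed

text \<open>
  Two commuting nilpotent operators with the same exponential are equal.  So \<open>N\<close> agrees with the
  logarithm provided by \<open>nilpotent_log\<close>, which lies in the bicommutant of \<open>exp N - 1\<close>.
\<close>
lemma commutes_if_commutes_exp_nilpotent:
  fixes N :: "'a::{banach,perfect_space} endo"
  assumes N: "nilpotent N" and Y: "Y * exp N = exp N * Y"
  shows "Y * N = N * Y"
proof -
  obtain \<psi> where \<psi>: "exp N = 1 + N + N * N * \<psi>" and c: "\<psi> * N = N * \<psi>"
    using exp_second_order_remainder[of N] by blast
  define M where "M = N * (1 + N * \<psi>)"
  have M: "exp N = 1 + M" by (simp add: M_def \<psi> algebra_simps)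
  have c': "N * (1 + N * \<psi>) = (1 + N * \<psi>) * N" by (simp add: algebra_simps c)
  then have nilM: "nilpotent M" unfolding M_def by (rule nilpotent_mult_commuting[OF N])
  have univ: "closed_subalgebra (UNIV :: 'a endo set)" by (simp add: closed_subalgebra_def)
  obtain r where "r \<in> UNIV" and rZ: "r \<in> centralizer (centralizer {M})"
    and exp_r: "exp (M * r) = 1 + M"
    by (rule nilpotent_log[OF univ UNIV_I nilM])
  have r: "X * r = r * X" if "X * M = M * X" for X
    using centralizerD[OF rZ, of X] that by (simp add: centralizer_def)
  have "M * N = N * ((1 + N * \<psi>) * N)" by (simp only: M_def mult.assoc)
  then have NM: "N * M = M * N" by (simp only: M_def c'[symmetric])
  have Nr: "N * r = r * N" by (rule r[OF NM])
  have Mr: "M * r = r * M" by (rule r) simp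
  \<comment> \<open>The difference of the two logarithms \<open>N\<close> and \<open>M * r\<close> is a multiple of \<open>N\<close>, hence nilpotent,
    and its exponential is \<open>1\<close>.\<close>
  define Z where "Z = 1 - (1 + N * \<psi>) * r"
  have NZ: "N - M * r = N * Z" by (simp add: Z_def M_def algebra_simps)
  have "N * ((1 + N * \<psi>) * r) = (1 + N * \<psi>) * (N * r)" by (simp only: c' flip: mult.assoc)
  also have "\<dots> = (1 + N * \<psi>) * r * N" by (simp only: Nr mult.assoc)
  finally have "N * ((1 + N * \<psi>) * r) = (1 + N * \<psi>) * r * N" .
  then have "N * Z = Z * N" unfolding Z_def by (simp only: right_diff_distrib left_diff_distrib) simp
  then have nil: "nilpotent (N - M * r)" unfolding NZ by (rule nilpotent_mult_commuting[OF N])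
  have "exp (N - M * r) = exp N * exp (- (M * r))"
  proof -
    have "N * (M * r) = M * (N * r)" by (simp add: NM flip: mult.assoc)
    also have "\<dots> = M * r * N" by (simp add: Nr mult.assoc)
    finally have "N * (- (M * r)) = - (M * r) * N" by simp
    then show ?thesis using exp_add_commuting[of N "- (M * r)"] by simp
  qed
  also have "\<dots> = exp (M * r) * exp (- (M * r))" using exp_r M by simp
  also have "\<dots> = 1" by (rule exp_minus_inverse)
  finally have "exp (N - M * r) = 1" .
  then have "(N - M * r) \<cdot> w = 0" for w by (intro nilpotent_exp_fixed_point[OF nil]) simp
  then have "N = M * r" by (intro endo_eqI) (metis endo_apply_simps(5) eq_iff_diff_eq_0)
  moreover have "Y * (M * r) = M * r * Y"
  proof -
    have YM: "Y * M = M * Y" using Y by (simp add: M algebra_simps)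
    have "Y * (M * r) = M * (Y * r)" by (simp only: YM flip: mult.assoc)
    then show ?thesis by (simp only: r[OF YM] mult.assoc)
  qed
  ultimately show ?thesis by simp
qed

section \<open>Manifolds and invariance of dimension\<close>

definition Rn :: "nat \<Rightarrow> (nat \<Rightarrow> real) set" where
  "Rn m = {x. \<forall>i\<ge>m. x i = 0}"

lemma Euclidean_space_eq_Rn: "Euclidean_space m = top_of_set (Rn m)"
  by (simp add: Euclidean_space_def euclidean_product_topology Rn_def)

text \<open>
  \<open>Euclidean_space m\<close> is \<open>Rn m\<close> with its topology as a subset of the type of sequences, so charts
  are homeomorphisms between subsets of topological types.
\<close>
lemma manifold_of_dim_iff:
  "manifold_of_dim m S \<longleftrightarrow>
    (\<forall>x\<in>S. \<exists>W V. openin (top_of_set S) W \<and> x \<in> W \<and> openin (top_of_set (Rn m)) V \<and> W homeomorphic V)"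
proof -
  have "top_of_set W homeomorphic_space subtopology (Euclidean_space m) V \<longleftrightarrow> W homeomorphic V"
    if "openin (top_of_set (Rn m)) V" for W :: "'a set" and V
    using openin_imp_subset[OF that]
    by (simp add: Euclidean_space_eq_Rn subtopology_subtopology Int_absorb1)
  then show ?thesis
    unfolding manifold_of_dim_def by (simp add: Euclidean_space_eq_Rn cong: conj_cong)
qed

lemma invariance_of_dimension_open:
  assumes U: "openin (top_of_set (Rn m)) U" "U \<noteq> {}"
    and f: "continuous_on U f" "inj_on f U" "f ` U \<subseteq> Rn n"
  shows "m \<le> n"
proof (rule ccontr)
  assume "\<not> m \<le> n"
  then have sub: "Rn n \<subseteq> Rn m" by (auto simp: Rn_def)
  have "U \<subseteq> Rn m" using U openin_imp_subset by blast
  then have "continuous_map (subtopology (Euclidean_space m) U) (Euclidean_space m) f"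
    using f sub by (auto simp: Euclidean_space_eq_Rn subtopology_subtopology Int_absorb1)
  then have "openin (top_of_set (Rn m)) (f ` U)"
    using invariance_of_domain_Euclidean_space[of m U f] U f by (simp add: Euclidean_space_eq_Rn)
  then obtain T where T: "open T" "f ` U = Rn m \<inter> T" by (auto simp: openin_open)
  obtain y where y: "y \<in> f ` U" using U by blast
  \<comment> \<open>The line through \<open>y\<close> in the direction of the coordinate \<open>n\<close> stays in \<open>Rn m\<close> but meets \<open>Rn n\<close>
    only in \<open>y\<close>, which is incompatible with \<open>f ` U\<close> being open in \<open>Rn m\<close>.\<close>
  define c where "c t = y(n := t)" for t :: real
  have "continuous_on UNIV c"
    unfolding c_def fun_upd_def
    by (rule continuous_on_coordinatewise_then_product)
       (rename_tac i, case_tac "i = n", simp_all)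
  then have "open (c -` T)" using T(1) by (simp add: open_vimage continuous_on_eq_continuous_at)
  moreover have cR: "c t \<in> Rn m" for t
    using y f(3) \<open>\<not> m \<le> n\<close> by (auto simp: c_def Rn_def)
  moreover have "c -` T = {0}"
  proof (intro equalityI subsetI)
    fix t assume "t \<in> c -` T"
    then have "c t \<in> f ` U" using cR T by auto
    then have "c t \<in> Rn n" using f(3) by blast
    then have "c t n = 0" by (simp add: Rn_def)
    then show "t \<in> {0}" by (simp add: c_def)
  next
    fix t :: real assume "t \<in> {0}"
    moreover have "y n = 0" using y f(3) by (auto simp: Rn_def)
    ultimately have "c t = y" by (auto simp: c_def)
    then show "t \<in> c -` T" using y T by auto
  qed
  ultimately show False by (simp add: not_open_singleton)
qed

text \<open>
  The transition map between two charts at \<open>x\<close> is a continuous injection between nonempty open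
  subsets of \<open>Rn m\<close> and \<open>Rn n\<close>.
\<close>
lemma manifold_dim_unique:
  assumes S: "manifold_of_dim m S" "openin (top_of_set X) S" "x \<in> S"
    and T: "manifold_of_dim n T" "openin (top_of_set X) T" "x \<in> T"
  shows "m = n"
proof -
  have le: "m \<le> n"
    if S: "manifold_of_dim m S" "openin (top_of_set X) S" "x \<in> S"
      and T: "manifold_of_dim n T" "openin (top_of_set X) T" "x \<in> T"
    for m n and S T :: "'a set"
  proof -
    obtain W V where W: "openin (top_of_set S) W" "x \<in> W" "openin (top_of_set (Rn m)) V"
        "W homeomorphic V"
      using S by (auto simp: manifold_of_dim_iff)
    obtain W' V' where W': "openin (top_of_set T) W'" "x \<in> W'" "openin (top_of_set (Rn n)) V'"
        "W' homeomorphic V'"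
      using T by (auto simp: manifold_of_dim_iff)
    obtain f g where fg: "homeomorphism W V f g" using W(4) by (auto simp: homeomorphic_def)
    obtain h k where hk: "homeomorphism W' V' h k" using W'(4) by (auto simp: homeomorphic_def)
    have "openin (top_of_set X) W" "openin (top_of_set X) W'"
      using openin_trans[OF W(1) S(2)] openin_trans[OF W'(1) T(2)] by simp_all
    then have "openin (top_of_set X) (W \<inter> W')" "W \<subseteq> X"
      by (rule openin_Int, blast dest: openin_imp_subset)
    then have "openin (top_of_set W) (W \<inter> W')"
      by (rule openin_subset_trans[of X, OF _ Int_lower1])
    then have "openin (top_of_set V) (f ` (W \<inter> W'))"
      by (rule homeomorphism_imp_open_map[OF fg])
    then have op: "openin (top_of_set (Rn m)) (f ` (W \<inter> W'))"
      using W(3) by (rule openin_trans)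
    have g: "g ` f ` (W \<inter> W') \<subseteq> W \<inter> W'"
      using fg by (auto simp: homeomorphism_def)
    have fsub: "f ` (W \<inter> W') \<subseteq> V" using fg by (auto simp: homeomorphism_def)
    show "m \<le> n"
    proof (rule invariance_of_dimension_open[OF op, where f = "h \<circ> g"])
      show "f ` (W \<inter> W') \<noteq> {}" using W W' by blast
      have gW: "g ` f ` (W \<inter> W') \<subseteq> W'" using g by blast
      have "continuous_on V g" "continuous_on W' h" using fg hk by (auto simp: homeomorphism_def)
      then show "continuous_on (f ` (W \<inter> W')) (h \<circ> g)"
        using continuous_on_subset[OF _ fsub] continuous_on_subset[OF _ gW]
        by (intro continuous_on_compose)
      have "inj_on g V" by (rule inj_on_inverseI[of _ f]) (use fg in \<open>simp add: homeomorphism_def\<close>)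
      moreover have "inj_on h W'"
        by (rule inj_on_inverseI[of _ k]) (use hk in \<open>simp add: homeomorphism_def\<close>)
      ultimately show "inj_on (h \<circ> g) (f ` (W \<inter> W'))"
        using inj_on_subset[OF _ fsub] inj_on_subset[OF _ gW] by (intro comp_inj_on)
      have "h ` W' \<subseteq> Rn n" 
        using openin_imp_subset[OF W'(3)] by (simp add: homeomorphism_image1[OF hk])
      then show "(h \<circ> g) ` f ` (W \<inter> W') \<subseteq> Rn n" using g by (auto simp: image_subset_iff)
    qed
  qed
  show ?thesis using le[OF S T] le[OF T S] by simp
qed

lemma manifold_of_dim_homeomorphic:
  assumes "manifold_of_dim m S" "S homeomorphic T"
  shows "manifold_of_dim m T"
proof -
  obtain f g where fg: "homeomorphism S T f g" using assms(2) by (auto simp: homeomorphic_def)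
  show ?thesis unfolding manifold_of_dim_iff
  proof
    fix y assume "y \<in> T"
    then have y: "g y \<in> S" "f (g y) = y" using fg by (auto simp: homeomorphism_def)
    obtain W V where W: "openin (top_of_set S) W" "g y \<in> W" "openin (top_of_set (Rn m)) V"
        "W homeomorphic V"
      using assms(1) y by (auto simp: manifold_of_dim_iff)
    have "openin (top_of_set T) (f ` W)" by (rule homeomorphism_imp_open_map[OF fg W(1)])
    moreover have "homeomorphism W (f ` W) f g"
      by (rule homeomorphism_of_subsets[OF fg]) (use W(1) fg in \<open>auto simp: homeomorphism_def dest: openin_imp_subset\<close>)
    then have "W homeomorphic f ` W" by (auto simp: homeomorphic_def)
    then have "f ` W homeomorphic V"
      using W(4) homeomorphic_sym homeomorphic_trans by blast
    moreover have "y \<in> f ` W" using W(2) y by (metis imageI)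
    ultimately show "\<exists>W V. openin (top_of_set T) W \<and> y \<in> W \<and> openin (top_of_set (Rn m)) V \<and> W homeomorphic V"
      using W(3) by blast
  qed
qed

lemma manifold_of_dim_open_in_subspace:
  assumes V: "subspace V" and W: "openin (top_of_set V) W"
  shows "manifold_of_dim (dim V) W"
proof -
  have "top_of_set V homeomorphic_space top_of_set (Rn (dim V))"
    using homeomorphic_subspace_Euclidean_space_dim[OF V] by (simp add: Euclidean_space_eq_Rn)
  then obtain f g where fg: "homeomorphism V (Rn (dim V)) f g" by (auto simp: homeomorphic_def)
  have "homeomorphism W (f ` W) f g"
    by (rule homeomorphism_of_subsets[OF fg]) (use W fg in \<open>auto simp: homeomorphism_def dest: openin_imp_subset\<close>)
  moreover have "openin (top_of_set (Rn (dim V))) (f ` W)"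
    by (rule homeomorphism_imp_open_map[OF fg W])
  moreover have "openin (top_of_set W) W" by simp
  ultimately show ?thesis unfolding manifold_of_dim_iff homeomorphic_def by blast
qed

section \<open>Closed subgroups of a Euclidean space\<close>

definition additive_subgroup :: "'a::ab_group_add set \<Rightarrow> bool" where
  "additive_subgroup F \<longleftrightarrow> 0 \<in> F \<and> (\<forall>x\<in>F. \<forall>y\<in>F. x - y \<in> F)"

lemma additive_subgroupD:
  assumes "additive_subgroup F"
  shows "0 \<in> F" "x \<in> F \<Longrightarrow> y \<in> F \<Longrightarrow> x - y \<in> F" "x \<in> F \<Longrightarrow> - x \<in> F"
    "x \<in> F \<Longrightarrow> y \<in> F \<Longrightarrow> x + y \<in> F"
proof -
  show 0: "0 \<in> F" using assms by (simp add: additive_subgroup_def)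
  show d: "x - y \<in> F" if "x \<in> F" "y \<in> F" for x y
    using assms that by (simp add: additive_subgroup_def)
  show m: "- x \<in> F" if "x \<in> F" for x using d[OF 0 that] by simp
  show "x + y \<in> F" if "x \<in> F" "y \<in> F" using d[OF that(1) m[OF that(2)]] by simp
qed

lemma additive_subgroup_closure:
  fixes F :: "'a::real_normed_vector set"
  assumes "additive_subgroup F"
  shows "additive_subgroup (closure F)"
  unfolding additive_subgroup_def
proof (intro conjI ballI)
  show "0 \<in> closure F" using additive_subgroupD(1)[OF assms] closure_subset by blast
  fix x y assume "x \<in> closure F" "y \<in> closure F"
  then obtain X Y where X: "\<And>n. X n \<in> F" "X \<longlonglongrightarrow> x" and Y: "\<And>n. Y n \<in> F" "Y \<longlonglongrightarrow> y"
    by (metis closure_sequential)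
  then have "(\<lambda>n. X n - Y n) \<longlonglongrightarrow> x - y" "\<And>n. X n - Y n \<in> F"
    using additive_subgroupD(2)[OF assms] by (auto intro: tendsto_diff)
  then show "x - y \<in> closure F"
    unfolding closure_sequential by (intro exI[of _ "\<lambda>n. X n - Y n"]) auto
qed

lemma additive_subgroup_of_int_scaleR:
  fixes F :: "'a::real_vector set"
  assumes "additive_subgroup F" "x \<in> F"
  shows "of_int k *\<^sub>R x \<in> F"
proof -
  have nat: "of_nat n *\<^sub>R x \<in> F" for n
    by (induction n) (auto simp: additive_subgroupD[OF assms(1)] assms(2) scaleR_add_left)
  show ?thesis
    using nat[of "nat k"] additive_subgroupD(3)[OF assms(1) nat[of "nat (- k)"]]
    by (cases "k \<ge> 0") (auto simp flip: scaleR_minus_left)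
qed

text \<open>For an additive subgroup this is the largest real subspace that it contains.\<close>
definition linear_part :: "'a::real_vector set \<Rightarrow> 'a set" where
  "linear_part F = {x. \<forall>t. t *\<^sub>R x \<in> F}"

lemma subspace_linear_part:
  assumes "additive_subgroup F"
  shows "subspace (linear_part F)"
  using additive_subgroupD[OF assms]
  by (auto simp: subspace_def linear_part_def scaleR_add_right)

lemma linear_part_subset: "linear_part F \<subseteq> F"
  by (auto simp: linear_part_def) (metis scaleR_one)

lemma closed_subgroup_dim_eq:
  fixes F :: "'a::euclidean_space set"
  assumes "additive_subgroup F"
  shows "closed_subgroup_dim F = dim (linear_part F)"
  unfolding closed_subgroup_dim_def
proof (rule Max_eqI)
  show "finite {dim V |V. subspace V \<and> V \<subseteq> F}"
    by (rule finite_subset[of _ "{..DIM('a)}"]) (auto intro: dim_subset_UNIV)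
  show "dim (linear_part F) \<in> {dim V |V. subspace V \<and> V \<subseteq> F}"
    using subspace_linear_part[OF assms] linear_part_subset by blast
  fix d assume "d \<in> {dim V |V. subspace V \<and> V \<subseteq> F}"
  then obtain V where V: "d = dim V" "subspace V" "V \<subseteq> F" by blast
  then have "V \<subseteq> linear_part F" by (auto simp: linear_part_def dest: subspace_mul)
  then show "d \<le> dim (linear_part F)" unfolding V(1) by (rule dim_subset)
qed

text \<open>
  Otherwise there are nonzero elements of \<open>F\<close> that are orthogonal to the linear part and tend to \<open>0\<close>.
  Let \<open>l\<close> be a limit of their directions.  Every multiple \<open>t l\<close> is a limit of integer multiples of
  them, so \<open>l\<close> belongs to the linear part, although it is a unit vector orthogonal to it.
\<close>
lemma closed_subgroup_locally_linear:
  fixes F :: "'a::euclidean_space set"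
  assumes F: "additive_subgroup F" "closed F"
  obtains e where "e > 0" "F \<inter> ball 0 e \<subseteq> linear_part F"
proof (rule ccontr)
  note * = that
  let ?V = "linear_part F"
  note V = subspace_linear_part[OF F(1)]
  assume "\<not> thesis"
  then have not_thesis: "\<not> F \<inter> ball 0 e \<subseteq> linear_part F" if "e > 0" for e
    using that * by blast
  then have neg: "\<exists>x. x \<in> F \<and> norm x < e \<and> x \<notin> ?V" if "e > 0" for e
    using that not_thesis[OF that] by (force simp: subset_iff dist_norm)
  have "\<exists>w. w \<in> F \<and> w \<noteq> 0 \<and> norm w < inverse (real (Suc n)) \<and> (\<forall>v\<in>?V. w \<bullet> v = 0)" for n
  proof -
    obtain x where x: "x \<in> F" "norm x < inverse (real (Suc n))" "x \<notin> ?V"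
      using neg[of "inverse (real (Suc n))"] by auto
    obtain v w where vw: "v \<in> span ?V" "\<And>a. a \<in> span ?V \<Longrightarrow> orthogonal w a" "x = v + w"
      using orthogonal_subspace_decomp_exists[of ?V x] by blast
    have v: "v \<in> ?V" using vw(1) V by (metis span_eq_iff)
    have "w = x - v" using vw(3) by simp
    then have "w \<in> F" using additive_subgroupD(2)[OF F(1) x(1)] v linear_part_subset by blast
    moreover have "w \<noteq> 0" using x(3) v vw(3) by auto
    moreover have "norm w \<le> norm x"
    proof -
      have "(norm x)\<^sup>2 = (norm v)\<^sup>2 + (norm w)\<^sup>2"
        unfolding vw(3) by (intro norm_add_Pythagorean) (use vw orthogonal_commute in blast)
      then have "(norm w)\<^sup>2 \<le> (norm x)\<^sup>2" by simp
      then show ?thesis by (rule power2_le_imp_le) simp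
    qed
    moreover have "w \<bullet> a = 0" if "a \<in> ?V" for a
      using vw(2)[OF span_base[OF that]] by (simp add: orthogonal_def)
    ultimately show ?thesis using x(2) le_less_trans by blast
  qed
  then have "\<exists>w. \<forall>n. w n \<in> F \<and> w n \<noteq> 0 \<and> norm (w n) < inverse (real (Suc n)) \<and> (\<forall>v\<in>?V. w n \<bullet> v = 0)"
    by (intro choice allI)
  then obtain w where w: "\<And>n. w n \<in> F" "\<And>n. w n \<noteq> 0" "\<And>n. norm (w n) < inverse (real (Suc n))"
      "\<And>n v. v \<in> ?V \<Longrightarrow> w n \<bullet> v = 0" by blast
  have "\<forall>n. sgn (w n) \<in> sphere 0 1" using w(2) by (simp add: norm_sgn)
  then obtain l r where l: "l \<in> sphere 0 1" and r: "strict_mono r" "((\<lambda>n. sgn (w n)) \<circ> r) \<longlonglongrightarrow> l"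
    by (rule seq_compactE[OF compact_imp_seq_compact[OF compact_sphere]])
  have r2: "(\<lambda>n. sgn (w (r n))) \<longlonglongrightarrow> l" using r(2) by (simp add: o_def)
  have w0: "(\<lambda>n. norm (w n)) \<longlonglongrightarrow> 0"
    by (rule tendsto_sandwich[OF _ _ tendsto_const LIMSEQ_inverse_real_of_nat])
       (simp_all only: eventually_sequentiallyI[OF less_imp_le[OF w(3)]] norm_ge_zero eventually_True)
  then have w0r: "(\<lambda>n. norm (w (r n))) \<longlonglongrightarrow> 0"
    using LIMSEQ_subseq_LIMSEQ[OF w0 r(1)] by (simp add: o_def)
  have "l \<in> ?V" unfolding linear_part_def
  proof safe
    fix t :: real
    \<comment> \<open>The multiple \<open>k n\<close> of \<open>w (r n)\<close> has length \<open>t\<close> up to an error of at most \<open>norm (w (r n))\<close>.\<close>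
    define k where "k n = \<lfloor>t / norm (w (r n))\<rfloor>" for n
    have lim: "(\<lambda>n. of_int (k n) *\<^sub>R w (r n)) \<longlonglongrightarrow> t *\<^sub>R l"
    proof -
      have eq: "of_int (k n) *\<^sub>R w (r n) = (of_int (k n) * norm (w (r n))) *\<^sub>R sgn (w (r n))" for n
        using w(2)[of "r n"] by (simp add: sgn_div_norm)
      have "\<bar>of_int (k n) * norm (w (r n)) - t\<bar> \<le> norm (w (r n))" for n
      proof -
        have p: "norm (w (r n)) > 0" using w(2) by simp
        have "of_int (k n) \<le> t / norm (w (r n))" "t / norm (w (r n)) < of_int (k n) + 1"
          unfolding k_def by linarith+
        then have "of_int (k n) * norm (w (r n)) \<le> t" "t < (of_int (k n) + 1) * norm (w (r n))"
          using p by (simp_all add: field_simps)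
        then show ?thesis by (simp add: algebra_simps)
      qed
      then have "(\<lambda>n. of_int (k n) * norm (w (r n)) - t) \<longlonglongrightarrow> 0"
        by (intro Lim_null_comparison[OF _ w0r]) (auto intro: eventuallyI)
      then have "(\<lambda>n. of_int (k n) * norm (w (r n))) \<longlonglongrightarrow> t" by (simp add: LIM_zero_iff)
      then show ?thesis unfolding eq by (intro tendsto_scaleR r2)
    qed
    have mem: "of_int (k n) *\<^sub>R w (r n) \<in> F" for n
      by (intro additive_subgroup_of_int_scaleR F w)
    show "t *\<^sub>R l \<in> F" by (rule closed_sequentially[OF F(2) mem lim])
  qed
  moreover have "(\<lambda>n. sgn (w (r n)) \<bullet> l) \<longlonglongrightarrow> l \<bullet> l" by (intro tendsto_intros r2)
  moreover have "sgn (w n) \<bullet> l = 0" if "l \<in> ?V" for n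
    using w(4)[OF that] by (simp add: sgn_div_norm)
  ultimately have "l \<bullet> l = 0" by (simp add: LIMSEQ_const_iff)
  then show False using l by simp
qed

section \<open>Regularity of orbits\<close>

text \<open>
  The maps are only required to be inverse to each other on the closures: for two orbits with the
  same span, the matrices that exchange them may be singular on the whole space.
\<close>
lemma manifold_closure_transport:
  fixes f :: "'a::euclidean_space \<Rightarrow> 'b::euclidean_space"
  assumes f: "continuous_on UNIV f" and g: "continuous_on UNIV g"
    and ST: "f ` S \<subseteq> T" "g ` T \<subseteq> S"
    and gf: "\<And>x. x \<in> closure S \<Longrightarrow> g (f x) = x" and fg: "\<And>y. y \<in> closure T \<Longrightarrow> f (g y) = y"
    and man: "manifold_of_dim m (closure S \<inter> Q)"
  shows "manifold_of_dim m (closure T \<inter> g -` Q)"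
proof (rule manifold_of_dim_homeomorphic[OF man])
  have fS: "f x \<in> closure T" if "x \<in> closure S" for x
    using image_closure_subset[of S f "closure T"] that ST(1) closure_subset
      continuous_on_subset[OF f] by blast
  have gT: "g y \<in> closure S" if "y \<in> closure T" for y
    using image_closure_subset[of T g "closure S"] that ST(2) closure_subset
      continuous_on_subset[OF g] by blast
  have "homeomorphism (closure S \<inter> Q) (closure T \<inter> g -` Q) f g"
    by (rule homeomorphismI)
       (use fS gT gf fg in \<open>auto intro: continuous_on_subset[OF f] continuous_on_subset[OF g]\<close>)
  then show "(closure S \<inter> Q) homeomorphic (closure T \<inter> g -` Q)" by (auto simp: homeomorphic_def)
qed

lemma regular_with_order_transport:
  fixes S T :: "(complex ^ 'n) set"
  assumes f: "continuous_on UNIV f" and g: "continuous_on UNIV g"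
    and ST: "f ` S \<subseteq> T" "g ` T \<subseteq> S"
    and gf: "\<And>x. x \<in> closure S \<Longrightarrow> g (f x) = x" and fg: "\<And>y. y \<in> closure T \<Longrightarrow> f (g y) = y"
    and reg: "regular_with_order m S"
  shows "regular_with_order m T"
  unfolding regular_with_order_def
proof
  fix y assume "y \<in> T"
  then have "g y \<in> S" using ST by blast
  then obtain Q where Q: "open Q" "g y \<in> Q" "manifold_of_dim m (closure S \<inter> Q)"
    using reg by (auto simp: regular_with_order_def)
  have "open (g -` Q)" using Q(1) g by (simp add: open_vimage)
  moreover have "manifold_of_dim m (closure T \<inter> g -` Q)"
    by (rule manifold_closure_transport[OF f g ST gf fg Q(3)])
  ultimately show "\<exists>Q. open Q \<and> y \<in> Q \<and> manifold_of_dim m (closure T \<inter> Q)"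
    using Q(2) by blast
qed

lemma matrix_inv_invertible:
  fixes A :: "complex ^ 'n ^ 'n"
  assumes "invertible A"
  shows "A ** matrix_inv A = mat 1" "matrix_inv A ** A = mat 1"
  unfolding matrix_inv_def
  using someI_ex[OF assms[unfolded invertible_def]] by auto

lemma matrix_mult_add_left: "(A + B) ** C = A ** C + (B ** C :: complex ^ 'n ^ 'm)"
  by (vector matrix_matrix_mult_def sum.distrib[symmetric] field_simps)

lemma scalar_matrix:
  fixes A :: "complex ^ 'n ^ 'n"
  shows "mat c ** A = A ** mat c" "mat c *v x = c *s x"
proof -
  have "(mat c ** A) $ i $ j = c * A $ i $ j" "(A ** mat c) $ i $ j = A $ i $ j * c" for i j
    by (simp_all add: matrix_matrix_mult_def mat_def if_distrib if_distribR cong: if_cong)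
  then show "mat c ** A = A ** mat c" by (simp add: vec_eq_iff mult.commute)
  show "mat c *v x = c *s x"
    by (simp add: vec_eq_iff matrix_vector_mult_def mat_def if_distrib if_distribR cong: if_cong)
qed

lemma abelian_subgroup_GL_simps:
  assumes "abelian_subgroup_GL G"
  shows "mat 1 \<in> G" "A \<in> G \<Longrightarrow> invertible A" "A \<in> G \<Longrightarrow> B \<in> G \<Longrightarrow> A ** B \<in> G"
    "A \<in> G \<Longrightarrow> matrix_inv A \<in> G" "A \<in> G \<Longrightarrow> B \<in> G \<Longrightarrow> A ** B = B ** A"
    "A \<in> G \<Longrightarrow> A ** matrix_inv A = mat 1" "A \<in> G \<Longrightarrow> matrix_inv A ** A = mat 1"
  using assms by (auto simp: abelian_subgroup_GL_def matrix_inv_invertible)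

lemma continuous_on_matrix_vector_mult: "continuous_on X ((*v) (A :: complex ^ 'n ^ 'm))"
  by (intro linear_continuous_on matrix_vector_mul_bounded_linear)

lemma self_in_orbit: "abelian_subgroup_GL G \<Longrightarrow> u \<in> orbit G u"
  using abelian_subgroup_GL_simps(1)[of G] by (auto simp: orbit_def intro!: exI[of _ "mat 1"])

lemma self_in_E_space: "abelian_subgroup_GL G \<Longrightarrow> u \<in> E_space G u"
  unfolding E_space_def by (intro vec.span_base self_in_orbit)

text \<open>Each element of the group maps the orbit onto itself and carries a good neighbourhood of \<open>u\<close>
  to one of any other given point of the orbit.\<close>
lemma regular_orbit_iff_local:
  assumes G: "abelian_subgroup_GL G"
  shows "regular_with_order m (orbit G u) \<longleftrightarrow>
    (\<exists>Q. open Q \<and> u \<in> Q \<and> manifold_of_dim m (closure (orbit G u) \<inter> Q))" (is "?L \<longleftrightarrow> ?R")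
proof
  note [simp] = abelian_subgroup_GL_simps[OF G]
  show "?L \<Longrightarrow> ?R" using self_in_orbit[OF G] by (auto simp: regular_with_order_def)
  assume ?R
  then obtain Q where Q: "open Q" "u \<in> Q" "manifold_of_dim m (closure (orbit G u) \<inter> Q)" by blast
  show ?L unfolding regular_with_order_def
  proof
    fix v assume "v \<in> orbit G u"
    then obtain A where A: "A \<in> G" "v = A *v u" by (auto simp: orbit_def)
    let ?f = "(*v) A" and ?g = "(*v) (matrix_inv A)"
    have inv: "?g (?f x) = x" "?f (?g x) = x" for x
      using A(1) by (simp_all add: matrix_vector_mul_assoc)
    have sub: "(*v) B ` orbit G u \<subseteq> orbit G u" if "B \<in> G" for B
      using that by (force simp: orbit_def matrix_vector_mul_assoc)
    have "manifold_of_dim m (closure (orbit G u) \<inter> ?g -` Q)"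
      by (rule manifold_closure_transport[of ?f])
         (use A(1) sub inv Q in \<open>simp_all add: continuous_on_matrix_vector_mult\<close>)
    moreover have "open (?g -` Q)"
      by (rule open_vimage[OF Q(1) continuous_on_matrix_vector_mult])
    moreover have "v \<in> ?g -` Q" using Q(2) A(2) inv by simp
    ultimately show "\<exists>Q. open Q \<and> v \<in> Q \<and> manifold_of_dim m (closure (orbit G u) \<inter> Q)"
      by blast
  qed
qed

text \<open>The vectors of this form are a complex subspace, and it contains the orbit because \<open>G\<close> is
  commutative.\<close>
lemma E_space_commuting_image:
  fixes G :: "(complex ^ 'n ^ 'n) set"
  assumes G: "abelian_subgroup_GL G" and x: "x \<in> E_space G u"
  obtains B where "x = B *v u" "\<And>A. A \<in> G \<Longrightarrow> A ** B = B ** A"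
proof -
  let ?T = "{B *v u |B. \<forall>A\<in>G. A ** B = B ** A}"
  have "vec.subspace ?T"
    unfolding vec.subspace_def
  proof (intro conjI ballI allI)
    show "0 \<in> ?T" by (auto intro!: exI[of _ 0] simp: matrix_vector_mult_0)
    fix x y assume "x \<in> ?T" "y \<in> ?T"
    then obtain B C where "x = B *v u" "y = C *v u" "\<forall>A\<in>G. A ** B = B ** A" "\<forall>A\<in>G. A ** C = C ** A"
      by blast
    then show "x + y \<in> ?T"
      by (auto intro!: exI[of _ "B + C"]
          simp: matrix_vector_mult_add_rdistrib matrix_add_ldistrib matrix_mult_add_left)
  next
    fix c and x assume "x \<in> ?T"
    then obtain B where "x = B *v u" "\<forall>A\<in>G. A ** B = B ** A" by blast
    then have "c *s x = (mat c ** B) *v u" "\<forall>A\<in>G. A ** (mat c ** B) = mat c ** B ** A"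
      by (simp_all add: scalar_matrix(2) flip: matrix_vector_mul_assoc)
         (metis matrix_mul_assoc scalar_matrix(1))
    then show "c *s x \<in> ?T" by blast
  qed
  moreover have "orbit G u \<subseteq> ?T"
    using abelian_subgroup_GL_simps(5)[OF G] by (auto simp: orbit_def)
  ultimately have "E_space G u \<subseteq> ?T" unfolding E_space_def by (intro vec.span_minimal)
  with x that show ?thesis by blast
qed

lemma regular_orbit_if_U_set:
  fixes G :: "(complex ^ 'n ^ 'n) set"
  assumes G: "abelian_subgroup_GL G" and v: "v \<in> U_set G u"
    and reg: "regular_with_order m (orbit G u)"
  shows "regular_with_order m (orbit G v)"
proof -
  obtain B where B: "v = B *v u" "\<And>A. A \<in> G \<Longrightarrow> A ** B = B ** A"
    using E_space_commuting_image[OF G, of v u] v by (auto simp: U_set_def)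
  obtain C where C: "u = C *v v" "\<And>A. A \<in> G \<Longrightarrow> A ** C = C ** A"
    using E_space_commuting_image[OF G, of u v] v self_in_E_space[OF G] by (auto simp: U_set_def)
  have im: "(*v) X ` orbit G w \<subseteq> orbit G (X *v w)" if "\<And>A. A \<in> G \<Longrightarrow> A ** X = X ** A" for X w
    using that by (force simp: orbit_def matrix_vector_mul_assoc)
  \<comment> \<open>The fixed points of \<open>Y ** X\<close> form a closed set, which contains the orbit of \<open>w\<close> with \<open>w\<close>.\<close>
  have inv: "Y *v (X *v x) = x"
    if X: "\<And>A. A \<in> G \<Longrightarrow> A ** X = X ** A" and Y: "\<And>A. A \<in> G \<Longrightarrow> A ** Y = Y ** A"
      and w: "Y *v (X *v w) = w" and x: "x \<in> closure (orbit G w)" for X Y w x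
  proof -
    have "Y *v (X *v (A *v w)) = A *v w" if "A \<in> G" for A
    proof -
      have "Y ** (X ** A) = A ** (Y ** X)"
        by (simp add: X[OF that, symmetric] matrix_mul_assoc Y[OF that])
      then show ?thesis using w by (metis matrix_vector_mul_assoc)
    qed
    then have "orbit G w \<subseteq> {x. Y *v (X *v x) = x}" by (auto simp: orbit_def)
    moreover have "closed {x. Y *v (X *v x) = x}"
      by (intro closed_Collect_eq continuous_on_id
          continuous_on_compose2[OF continuous_on_matrix_vector_mult[of UNIV] continuous_on_matrix_vector_mult]) auto
    ultimately show ?thesis using x closure_minimal by blast
  qed
  show ?thesis
  proof (rule regular_with_order_transport[OF _ _ _ _ _ _ reg])
    show "continuous_on UNIV ((*v) B)" "continuous_on UNIV ((*v) C)"
      by (rule continuous_on_matrix_vector_mult)+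
    show "(*v) B ` orbit G u \<subseteq> orbit G v" unfolding B(1) by (rule im[OF B(2)])
    show "(*v) C ` orbit G v \<subseteq> orbit G u" unfolding C(1) by (rule im[OF C(2)])
    show "C *v (B *v x) = x" if "x \<in> closure (orbit G u)" for x
      by (rule inv[OF B(2) C(2) _ that]) (simp_all flip: B(1) C(1))
    show "B *v (C *v x) = x" if "x \<in> closure (orbit G v)" for x
      by (rule inv[OF C(2) B(2) _ that]) (simp_all flip: B(1) C(1))
  qed
qed

lemma regular_orbit_iff_U_set:
  fixes G :: "(complex ^ 'n ^ 'n) set"
  assumes G: "abelian_subgroup_GL G"
  shows "regular_with_order m (orbit G u) \<longleftrightarrow> (\<forall>v\<in>U_set G u. regular_with_order m (orbit G v))"
proof -
  have "u \<in> U_set G u" by (simp add: U_set_def self_in_E_space[OF G])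
  then show ?thesis using regular_orbit_if_U_set[OF G] by blast
qed

section \<open>The exponential chart\<close>

lemma exp_apply_kernel:
  fixes T :: "'a::{banach,perfect_space} endo"
  assumes "T \<cdot> x = 0"
  shows "exp T \<cdot> x = x"
proof -
  obtain \<psi> where \<psi>: "exp T = 1 + T + T * T * \<psi>" "\<psi> * T = T * \<psi>"
    using exp_second_order_remainder[of T] by blast
  have "\<psi> * T = T * \<psi>" by (rule \<psi>(2))
  then have "T * T * \<psi> = T * \<psi> * T" by (simp add: mult.assoc)
  then show ?thesis by (simp add: \<psi>(1) assms endo.zero_right)
qed

text \<open>
  Together with the functional equation on a commutative algebra, continuity of \<open>exp\<close> at \<open>0\<close>
  gives the continuity of the chart at every point.
\<close>
lemma tendsto_exp_at_0: "(exp \<longlongrightarrow> (1 :: 'b::{real_normed_algebra_1,banach})) (at 0)"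
proof -
  have "((\<lambda>x::'b. exp (norm x) - 1) \<longlongrightarrow> exp (norm (0::'b)) - 1) (at 0)"
    by (rule tendsto_diff[OF tendsto_exp[OF tendsto_norm[OF tendsto_ident_at]] tendsto_const])
  then have lim: "((\<lambda>x::'b. exp (norm x) - 1) \<longlongrightarrow> 0) (at 0)" by simp
  have "((\<lambda>x::'b. exp x - 1) \<longlongrightarrow> 0) (at 0)"
    by (rule Lim_null_comparison[OF always_eventually[OF allI[OF norm_exp_minus_1_le]] lim])
  then show ?thesis by (simp add: LIM_zero_iff)
qed

text \<open>
  The commutative algebra \<open>\<C>\<close> contains the group \<open>\<H>\<close> of logarithms of the group that acts on \<open>u\<close>.
  The last two assumptions describe the logarithms \<open>X\<close> in \<open>\<C>\<close> of stabilizers of \<open>u\<close>: the points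
  \<open>X u\<close> come from \<open>\<H>\<close>, and \<open>0\<close> is isolated among them.
\<close>
locale exp_orbit =
  fixes \<C> \<H> :: "'a::euclidean_space endo set" and u :: 'a
  assumes subspace_C: "subspace \<C>" and one_C: "1 \<in> \<C>"
    and mult_C: "X \<in> \<C> \<Longrightarrow> Y \<in> \<C> \<Longrightarrow> X * Y \<in> \<C>"
    and commute: "X \<in> \<C> \<Longrightarrow> Y \<in> \<C> \<Longrightarrow> X * Y = Y * X"
    and H_sub: "\<H> \<subseteq> \<C>" and H_grp: "additive_subgroup \<H>"
    and stabilizer_in_H: "X \<in> \<C> \<Longrightarrow> exp X \<cdot> u = u \<Longrightarrow> \<exists>Y\<in>\<H>. X \<cdot> u = Y \<cdot> u"
    and stabilizer_discrete: "\<exists>r>0. \<forall>X\<in>\<C>. exp X \<cdot> u = u \<and> norm (X \<cdot> u) < r \<longrightarrow> X \<cdot> u = 0"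
begin

definition W where "W = (\<lambda>X. X \<cdot> u) ` \<C>"
definition Hu where "Hu = (\<lambda>X. X \<cdot> u) ` \<H>"
definition expH_u where "expH_u = (\<lambda>X. exp X \<cdot> u) ` \<H>"

lemma linear_eval: "linear (\<lambda>X. X \<cdot> x)" for x :: 'a
  by (rule bounded_linear.linear[OF endo.bounded_linear_left])

lemma subspace_W: "subspace W"
  unfolding W_def by (rule linear_subspace_image[OF linear_eval subspace_C])

lemma closed_W: "closed W"
  by (rule closed_subspace[OF subspace_W])

lemma mult_W: "X \<in> \<C> \<Longrightarrow> x \<in> W \<Longrightarrow> X \<cdot> x \<in> W"
proof -
  assume "X \<in> \<C>" "x \<in> W"
  then obtain Y where "Y \<in> \<C>" "x = Y \<cdot> u" by (auto simp: W_def)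
  then have "X \<cdot> x = (X * Y) \<cdot> u" by simp
  moreover have "X * Y \<in> \<C>" by (rule mult_C) fact+
  ultimately show "X \<cdot> x \<in> W" unfolding W_def by (rule image_eqI)
qed

lemma power_C: "X \<in> \<C> \<Longrightarrow> X ^ n \<in> \<C>"
  by (induction n) (simp_all add: one_C mult_C)

lemma exp_W:
  assumes "X \<in> \<C>" "x \<in> W"
  shows "exp X \<cdot> x \<in> W"
proof (rule Lim_in_closed_set[OF closed_W])
  have "(\<lambda>n. (X ^ n /\<^sub>R fact n) \<cdot> x) sums (exp X \<cdot> x)"
    by (rule bounded_linear.sums[OF endo.bounded_linear_left exp_converges])
  then show "(\<lambda>n. \<Sum>i<n. (X ^ i /\<^sub>R fact i) \<cdot> x) \<longlonglongrightarrow> exp X \<cdot> x"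
    by (simp add: sums_def)
  have "(\<Sum>i<n. (X ^ i /\<^sub>R fact i) \<cdot> x) \<in> W" for n
    by (intro subspace_sum[OF subspace_W] mult_W subspace_mul[OF subspace_C] power_C assms)
  then show "\<forall>\<^sub>F n in sequentially. (\<Sum>i<n. (X ^ i /\<^sub>R fact i) \<cdot> x) \<in> W" by simp
qed simp

lemma u_W: "u \<in> W"
  unfolding W_def using one_C by (intro image_eqI[of _ _ 1]) simp_all

lemma exists_section: "\<exists>s. linear s \<and> range s \<subseteq> \<C> \<and> (\<forall>x\<in>W. s x \<cdot> u = x)"
proof -
  obtain s where "range s \<subseteq> \<C>" "linear s" "\<forall>x\<in>(\<lambda>X. X \<cdot> u) ` \<C>. s x \<cdot> u = x"
    using linear_exists_right_inverse_on[OF linear_eval[of u] subspace_C] by (elim exE conjE)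
  then show ?thesis unfolding W_def by (intro exI[of _ s] conjI)
qed

text \<open>Any linear section of the evaluation at \<open>u\<close> serves, since the chart does not depend on it.\<close>
definition lift where "lift = (SOME s. linear s \<and> range s \<subseteq> \<C> \<and> (\<forall>x\<in>W. s x \<cdot> u = x))"

lemma lift: "linear lift" "lift x \<in> \<C>" "x \<in> W \<Longrightarrow> lift x \<cdot> u = x"
proof -
  have *: "linear lift \<and> range lift \<subseteq> \<C> \<and> (\<forall>x\<in>W. lift x \<cdot> u = x)"
    unfolding lift_def by (rule someI_ex[OF exists_section])
  show "linear lift" using * by (elim conjE)
  show "lift x \<in> \<C>" using * by (simp add: image_subset_iff)
  show "x \<in> W \<Longrightarrow> lift x \<cdot> u = x" using * by simp
qed

definition chart where "chart x = exp (lift x) \<cdot> u"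

lemma chart_add: "chart (x + y) = exp (lift x) \<cdot> chart y"
proof -
  have "exp (lift x + lift y) = exp (lift x) * exp (lift y)"
    by (intro exp_add_commuting commute lift(2))
  then show ?thesis by (simp add: chart_def linear_add[OF lift(1)])
qed

lemma chart_0: "chart 0 = u"
  by (simp add: chart_def linear_0[OF lift(1)])

lemma chart_in_W: "chart x \<in> W"
  unfolding chart_def by (intro exp_W lift u_W)

text \<open>
  The choice of \<open>lift\<close> does not matter: two elements of \<open>\<C>\<close> with the same value at \<open>u\<close>
  differ by some \<open>K\<close> with \<open>K u = 0\<close>, and \<open>exp K\<close> fixes \<open>u\<close>.
\<close>
lemma chart_eval:
  assumes "X \<in> \<C>"
  shows "chart (X \<cdot> u) = exp X \<cdot> u"
proof -
  define K where "K = lift (X \<cdot> u) - X"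
  have K: "K \<in> \<C>" unfolding K_def by (intro subspace_diff subspace_C lift assms)
  have "X \<cdot> u \<in> W" using assms by (auto simp: W_def)
  then have "K \<cdot> u = 0" by (simp add: K_def lift(3))
  moreover have "lift (X \<cdot> u) = X + K" by (simp add: K_def)
  ultimately show ?thesis
    by (simp add: chart_def exp_add_commuting[OF commute[OF assms K]] exp_apply_kernel)
qed

lemma exp_lift_cancel: "exp (lift x) \<cdot> a = exp (lift x) \<cdot> b \<longleftrightarrow> a = b"
proof
  assume "exp (lift x) \<cdot> a = exp (lift x) \<cdot> b"
  then have "(exp (- lift x) * exp (lift x)) \<cdot> a = (exp (- lift x) * exp (lift x)) \<cdot> b" by simp
  moreover have "exp (- lift x) * exp (lift x) = 1"
    using exp_minus_inverse[of "- lift x"] by simp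
  ultimately show "a = b" by simp
qed simp

lemma chart_eq_iff: "chart x = chart y \<longleftrightarrow> chart (x - y) = u"
proof -
  have "chart x = exp (lift y) \<cdot> chart (x - y)" using chart_add[of y "x - y"] by simp
  moreover have "chart y = exp (lift y) \<cdot> u" by (simp add: chart_def)
  ultimately show ?thesis by (simp add: exp_lift_cancel)
qed

lemma chart_stabilizer:
  assumes "x \<in> W" "chart x = u"
  shows "x \<in> Hu"
proof -
  have "exp (lift x) \<cdot> u = u" using assms(2) by (simp only: chart_def)
  then obtain Y where Y: "Y \<in> \<H>" "lift x \<cdot> u = Y \<cdot> u"
    using stabilizer_in_H[OF lift(2), of x] by blast
  then have "x = Y \<cdot> u" using lift(3)[OF assms(1)] by simp
  with Y(1) show ?thesis unfolding Hu_def by (rule image_eqI[rotated])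
qed

lemma isCont_chart: "isCont chart x"
proof -
  have "isCont lift 0"
    using lift(1) by (simp add: linear_continuous_at linear_conv_bounded_linear)
  then have "(lift \<longlongrightarrow> 0) (at 0)" by (simp add: isCont_def linear_0[OF lift(1)])
  then have "((\<lambda>h. exp (lift h)) \<longlongrightarrow> exp 0) (at 0)"
    using tendsto_exp_at_0 by (intro isCont_tendsto_compose[where g = exp]) (simp_all add: isCont_def)
  then have "((\<lambda>h. exp (lift x) \<cdot> exp (lift h) \<cdot> u) \<longlongrightarrow> exp (lift x) \<cdot> exp 0 \<cdot> u) (at 0)"
    by (intro endo.tendsto tendsto_const)
  then have "((\<lambda>h. chart (x + h)) \<longlongrightarrow> chart x) (at 0)"
    unfolding chart_add unfolding chart_def by simp
  then show ?thesis by (simp add: isCont_iff)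
qed

lemma continuous_on_chart: "continuous_on S chart"
  by (intro continuous_at_imp_continuous_on ballI isCont_chart)

lemma additive_subgroup_Hu: "additive_subgroup Hu"
  unfolding additive_subgroup_def Hu_def
proof (intro conjI ballI)
  show "0 \<in> (\<lambda>X. X \<cdot> u) ` \<H>"
    using additive_subgroupD(1)[OF H_grp] by (intro image_eqI[of _ _ 0]) simp_all
  fix x y assume "x \<in> (\<lambda>X. X \<cdot> u) ` \<H>" "y \<in> (\<lambda>X. X \<cdot> u) ` \<H>"
  then obtain X Y where "X \<in> \<H>" "Y \<in> \<H>" "x = X \<cdot> u" "y = Y \<cdot> u" by blast
  then show "x - y \<in> (\<lambda>X. X \<cdot> u) ` \<H>"
    using additive_subgroupD(2)[OF H_grp, of X Y] by (intro image_eqI[of _ _ "X - Y"]) simp_all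
qed

lemma Hu_subset_W: "Hu \<subseteq> W" and expH_u_subset_W: "expH_u \<subseteq> W"
proof -
  show "Hu \<subseteq> W" unfolding Hu_def W_def by (rule image_mono[OF H_sub])
  show "expH_u \<subseteq> W" unfolding expH_u_def using H_sub by (auto intro: exp_W u_W)
qed

text \<open>
  If \<open>chart x = exp(X) u\<close> with \<open>X\<close> in \<open>\<H>\<close>, then \<open>x - X u\<close> lies in the fibre over \<open>u\<close>, hence in the
  group \<open>\<H> u\<close>.
\<close>
lemma chart_preimage:
  assumes "x \<in> W"
  shows "chart x \<in> expH_u \<longleftrightarrow> x \<in> Hu"
proof
  assume "x \<in> Hu"
  then show "chart x \<in> expH_u" using H_sub
    by (auto simp: Hu_def expH_u_def chart_eval[OF subsetD[OF H_sub]])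
next
  assume "chart x \<in> expH_u"
  then obtain X where X: "X \<in> \<H>" "chart x = exp X \<cdot> u" by (auto simp: expH_u_def)
  then have Xu: "X \<cdot> u \<in> Hu" by (auto simp: Hu_def)
  have "chart x = chart (X \<cdot> u)" using X(2) chart_eval[OF subsetD[OF H_sub X(1)]] by simp
  then have "chart (x - X \<cdot> u) = u" by (simp add: chart_eq_iff)
  moreover have "x - X \<cdot> u \<in> W"
    using Xu Hu_subset_W assms by (intro subspace_diff subspace_W) auto
  ultimately have "x - X \<cdot> u \<in> Hu" by (intro chart_stabilizer)
  then have "x - X \<cdot> u + X \<cdot> u \<in> Hu" using Xu by (rule additive_subgroupD(4)[OF additive_subgroup_Hu])
  then show "x \<in> Hu" by simp
qed

text \<open>
  On a small ball \<open>N\<close> of \<open>W\<close> the chart is injective, hence by invariance of domain a homeomorphism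
  onto an open subset of \<open>W\<close>.  As \<open>\<H> u\<close> is the preimage of the orbit, the chart matches the two
  closures inside \<open>N\<close>, and the closure of \<open>\<H> u\<close> is linear there.
\<close>
lemma locally_manifold:
  "\<exists>Q. open Q \<and> u \<in> Q \<and>
     manifold_of_dim (closed_subgroup_dim (closure Hu)) (closure expH_u \<inter> Q)"
proof -
  define F where "F = closure Hu"
  define V where "V = linear_part F"
  have F: "additive_subgroup F" "closed F"
    unfolding F_def by (auto intro: additive_subgroup_closure additive_subgroup_Hu)
  have V: "subspace V" "V \<subseteq> F" unfolding V_def by (auto intro: subspace_linear_part F dest: subsetD[OF linear_part_subset])
  have FW: "F \<subseteq> W" unfolding F_def by (rule closure_minimal[OF Hu_subset_W closed_W])
  obtain e where e: "e > 0" "F \<inter> ball 0 e \<subseteq> V"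
    using closed_subgroup_locally_linear[OF F] unfolding V_def by blast
  obtain r where r: "r > 0" "\<And>X. X \<in> \<C> \<Longrightarrow> exp X \<cdot> u = u \<Longrightarrow> norm (X \<cdot> u) < r \<Longrightarrow> X \<cdot> u = 0"
    using stabilizer_discrete by blast
  \<comment> \<open>Two points of the ball of radius \<open>r / 2\<close> differ by less than \<open>r\<close>.\<close>
  define d where "d = min e (r / 2)"
  define N where "N = W \<inter> ball 0 d"
  have d: "d > 0" using e r by (simp add: d_def)
  have inj: "inj_on chart N"
  proof (rule inj_onI)
    fix x y assume xy: "x \<in> N" "y \<in> N" "chart x = chart y"
    then have "chart (x - y) = u" by (simp add: chart_eq_iff)
    moreover have "x - y \<in> W" using xy by (simp add: N_def subspace_diff subspace_W)
    moreover have "norm (x - y) < r"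
      using xy norm_triangle_ineq4[of x y] by (simp add: N_def d_def)
    ultimately have "x - y = 0"
      using r(2)[of "lift (x - y)"] lift by (simp add: chart_def)
    then show "x = y" by simp
  qed
  have opN: "openin (top_of_set W) N" unfolding N_def by (simp add: openin_open_Int)
  have open_map: "openin (top_of_set W) (chart ` M)" if M: "openin (top_of_set W) M" "M \<subseteq> N" for M
    by (rule invariance_of_domain_subspaces[OF M(1) subspace_W subspace_W order_refl
          continuous_on_chart _ inj_on_subset[OF inj M(2)]]) (simp add: chart_in_W)
  obtain Q where Q: "open Q" "chart ` N = W \<inter> Q"
    using open_map[OF opN order_refl] by (auto simp: openin_open)
  have uQ: "u \<in> Q"
  proof -
    have "0 \<in> N" using d subspace_0[OF subspace_W] by (simp add: N_def)
    then have "chart 0 \<in> chart ` N" by (rule imageI)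
    then show ?thesis using Q(2) by (simp add: chart_0)
  qed
  have OW: "closure expH_u \<subseteq> W" by (rule closure_minimal[OF expH_u_subset_W closed_W])
  have eq: "closure expH_u \<inter> Q = chart ` (F \<inter> N)"
  proof (intro equalityI subsetI)
    fix y assume y: "y \<in> closure expH_u \<inter> Q"
    then have "y \<in> chart ` N" using Q(2) OW by blast
    then obtain x where x: "x \<in> N" "y = chart x" by blast
    have "x \<in> F"
    proof (rule ccontr)
      assume "x \<notin> F"
      \<comment> \<open>The image of \<open>N - F\<close> would be a neighbourhood of \<open>y\<close> in \<open>W\<close> that contains no point of the
        orbit.\<close>
      have "N - F = N \<inter> - F" by blast
      then have "openin (top_of_set W) (N - F)" using opN F(2) by (auto intro: openin_Int_open)
      then have "openin (top_of_set W) (chart ` (N - F))" by (rule open_map) blast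
      then obtain T where T: "open T" "chart ` (N - F) = W \<inter> T" by (auto simp: openin_open)
      have "y \<in> T" using x \<open>x \<notin> F\<close> T(2) by blast
      then obtain z where z: "z \<in> expH_u" "z \<in> T"
        using y T(1) open_Int_closure_eq_empty[of T expH_u] by blast
      then have "z \<in> chart ` (N - F)" using T(2) expH_u_subset_W by blast
      then obtain x' where x': "x' \<in> N" "x' \<notin> F" "z = chart x'" by blast
      then have "x' \<in> Hu" using z(1) chart_preimage by (simp add: N_def)
      then show False using x'(2) closure_subset by (auto simp: F_def)
    qed
    then show "y \<in> chart ` (F \<inter> N)" using x by blast
  next
    fix y assume "y \<in> chart ` (F \<inter> N)"
    then obtain x where x: "x \<in> F" "x \<in> N" "y = chart x" by blast
    have "chart ` Hu \<subseteq> closure expH_u"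
      using chart_preimage Hu_subset_W closure_subset by blast
    then have "chart ` closure Hu \<subseteq> closure expH_u"
      by (intro image_closure_subset continuous_on_chart closed_closure)
    then show "y \<in> closure expH_u \<inter> Q" using x Q(2) by (auto simp: F_def)
  qed
  have FN: "F \<inter> N = V \<inter> ball 0 d"
    using e(2) V(2) FW by (auto simp: N_def d_def)
  have "manifold_of_dim (dim V) (F \<inter> N)"
    unfolding FN by (intro manifold_of_dim_open_in_subspace V openin_open_Int open_ball)
  moreover have "(F \<inter> N) homeomorphic (closure expH_u \<inter> Q)"
  proof -
    obtain g where g: "homeomorphism N (chart ` N) chart g"
    proof (rule homeomorphism_injective_open_map[OF continuous_on_chart refl inj])
      fix M assume "openin (top_of_set N) M"
      then have "openin (top_of_set W) M" "M \<subseteq> N"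
        using opN by (auto intro: openin_trans dest: openin_imp_subset)
      then have "openin (top_of_set W) (chart ` M)" by (rule open_map)
      then show "openin (top_of_set (chart ` N)) (chart ` M)"
        by (rule openin_subset_trans) (use \<open>M \<subseteq> N\<close> chart_in_W in auto)
    qed
    have "homeomorphism (F \<inter> N) (closure expH_u \<inter> Q) chart g"
      by (rule homeomorphism_of_subsets[OF g]) (auto simp: eq)
    then show ?thesis by (auto simp: homeomorphic_def)
  qed
  ultimately have "manifold_of_dim (dim V) (closure expH_u \<inter> Q)"
    by (rule manifold_of_dim_homeomorphic)
  moreover have "closed_subgroup_dim (closure Hu) = dim V"
    using closed_subgroup_dim_eq[OF F(1)] by (simp add: F_def V_def)
  ultimately show ?thesis using Q(1) uQ by auto
qed

end

section \<open>Commutative groups in an algebra with scalar blocks\<close>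

text \<open>
  In the application and up to a change of basis, \<open>K\<close> is the algebra of block diagonal matrices with triangular blocks of
  constant diagonal, \<open>I\<close> is the set of blocks, \<open>D l\<close> is the matrix that acts on the block \<open>k\<close> as the
  scalar \<open>l k\<close>, and \<open>\<Gamma>\<close> is the given abelian group.  Subtracting the diagonal part of an element of
  \<open>K\<close> leaves a nilpotent one.  Complex scalars enter only through \<open>D\<close>, so that the algebra itself
  can be treated as a real one.
\<close>
locale block_algebra =
  fixes K :: "'a::euclidean_space endo set" and D :: "(nat \<Rightarrow> complex) \<Rightarrow> 'a endo"
    and I :: "nat set" and \<Gamma> :: "'a endo set"
  assumes K: "closed_subalgebra K"
    and D_in_K: "D l \<in> K"
    and D_central: "X \<in> K \<Longrightarrow> D l * X = X * D l"
    and D_add: "D (\<lambda>k. l k + m k) = D l + D m"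
    and D_mult: "D (\<lambda>k. l k * m k) = D l * D m"
    and D_scaleR: "D (\<lambda>k. of_real r * l k) = r *\<^sub>R D l"
    and D_one: "D (\<lambda>k. 1) = 1"
    and D_exp: "exp (D l) = D (\<lambda>k. exp (l k))"
    and D_cong: "(\<And>k. k \<in> I \<Longrightarrow> l k = m k) \<Longrightarrow> D l = D m"
    and finite_I: "finite I"
    and D_unit_nonzero: "k \<in> I \<Longrightarrow> D (\<lambda>j. if j = k then 1 else 0) \<noteq> 0"
    and decomposition: "X \<in> K \<Longrightarrow> \<exists>l N. X = D l + N \<and> nilpotent N"
    and \<Gamma>_sub: "\<Gamma> \<subseteq> K" and \<Gamma>_one: "1 \<in> \<Gamma>"
    and \<Gamma>_mult: "A \<in> \<Gamma> \<Longrightarrow> B \<in> \<Gamma> \<Longrightarrow> A * B \<in> \<Gamma>"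
    and \<Gamma>_inverse: "A \<in> \<Gamma> \<Longrightarrow> \<exists>B\<in>\<Gamma>. A * B = 1"
    and \<Gamma>_commute: "A \<in> \<Gamma> \<Longrightarrow> B \<in> \<Gamma> \<Longrightarrow> A * B = B * A"
begin

definition proj where "proj k = D (\<lambda>j. if j = k then 1 else 0)"
text \<open>
  The bicommutant of \<open>\<Gamma>\<close> relative to \<open>K\<close>.  It is commutative because \<open>\<Gamma>\<close> is, it contains \<open>\<Gamma>\<close> and all
  \<open>D l\<close>, and it also contains the logarithms of the elements of \<open>\<Gamma>\<close>, even though these need not be
  limits of polynomials in \<open>\<Gamma>\<close>: two blocks with the same eigenvalue may have logarithms that differ
  by a multiple of \<open>2 \<pi> i\<close>.
\<close>
definition \<C> where "\<C> = K \<inter> centralizer (K \<inter> centralizer \<Gamma>)"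
definition log_\<Gamma> where "log_\<Gamma> = {X \<in> K. exp X \<in> \<Gamma>}"

lemmas K_simps = closed_subalgebra_simps[OF K]

lemma closed_subalgebra_C: "closed_subalgebra \<C>"
  unfolding \<C>_def by (intro closed_subalgebra_Int K closed_subalgebra_centralizer)

lemmas C_simps = closed_subalgebra_simps[OF closed_subalgebra_C]

lemma C_subset_K: "X \<in> \<C> \<Longrightarrow> X \<in> K"
  by (simp add: \<C>_def)

lemma in_C_I: "X \<in> K \<Longrightarrow> (\<And>Y. Y \<in> K \<Longrightarrow> Y \<in> centralizer \<Gamma> \<Longrightarrow> X * Y = Y * X) \<Longrightarrow> X \<in> \<C>"
  unfolding \<C>_def by (intro IntI centralizerI) simp_all

lemma \<Gamma>_in_C: "A \<in> \<Gamma> \<Longrightarrow> A \<in> \<C>"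
  by (intro in_C_I subsetD[OF \<Gamma>_sub]) (simp_all add: centralizerD[symmetric])

lemma D_in_C: "D l \<in> \<C>"
  by (intro in_C_I D_in_K D_central)

lemma C_commute:
  assumes X: "X \<in> \<C>" and Y: "Y \<in> \<C>"
  shows "X * Y = Y * X"
proof -
  have "A \<in> K \<inter> centralizer \<Gamma>" if "A \<in> \<Gamma>" for A
    using that \<Gamma>_sub \<Gamma>_commute by (auto intro: centralizerI)
  then have "Y * A = A * Y" if "A \<in> \<Gamma>" for A
    using Y that by (auto simp: \<C>_def dest: centralizerD)
  then have "Y \<in> K \<inter> centralizer \<Gamma>" using Y by (auto simp: \<C>_def intro: centralizerI)
  then show ?thesis using X by (auto simp: \<C>_def dest: centralizerD)
qed

lemma decompositionE:
  assumes "X \<in> K"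
  obtains l N where "X = D l + N" "nilpotent N" "N \<in> K" "exp X = D (\<lambda>k. exp (l k)) * exp N"
proof -
  obtain l N where X: "X = D l + N" "nilpotent N" using decomposition[OF assms] by (elim exE conjE)
  have "N = X - D l" using X(1) by simp
  then have N: "N \<in> K" using assms by (simp add: K_simps D_in_K)
  have "exp X = D (\<lambda>k. exp (l k)) * exp N"
    unfolding X(1) D_exp[symmetric] by (rule exp_add_commuting[OF D_central[OF N]])
  with X N show ?thesis by (rule that)
qed

text \<open>
  What commutes with \<open>exp X\<close> and with the \<open>D l\<close> commutes with the unipotent part \<open>exp N\<close> of \<open>exp X\<close>,
  hence with \<open>N\<close>.
\<close>
lemma log_\<Gamma>_subset_C: "log_\<Gamma> \<subseteq> \<C>"
proof
  fix X assume X: "X \<in> log_\<Gamma>"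
  then have "X \<in> K" by (simp add: log_\<Gamma>_def)
  then obtain l N where N: "X = D l + N" "nilpotent N" "N \<in> K" "exp X = D (\<lambda>k. exp (l k)) * exp N"
    by (rule decompositionE)
  show "X \<in> \<C>"
  proof (rule in_C_I)
    show "X \<in> K" using X by (simp add: log_\<Gamma>_def)
    fix Y assume Y: "Y \<in> K" "Y \<in> centralizer \<Gamma>"
    define E where "E = D (\<lambda>k. exp (- l k))"
    have "E * D (\<lambda>k. exp (l k)) = 1"
      by (simp add: E_def flip: D_mult exp_add) (rule D_one)
    then have expN: "exp N = E * exp X" by (simp add: N(4) flip: mult.assoc)
    have XY: "Y * exp X = exp X * Y" using X Y(2) by (auto simp: log_\<Gamma>_def dest: centralizerD)
    have EY: "E * Y = Y * E" unfolding E_def by (rule D_central[OF Y(1)])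
    have "Y * exp N = E * (Y * exp X)" by (simp only: expN EY flip: mult.assoc)
    also have "\<dots> = exp N * Y" by (simp only: expN XY mult.assoc)
    finally have "Y * N = N * Y" by (rule commutes_if_commutes_exp_nilpotent[OF N(2)])
    then show "X * Y = Y * X" using D_central[OF Y(1)] by (simp add: N(1) algebra_simps)
  qed
qed

lemma additive_subgroup_log_\<Gamma>: "additive_subgroup log_\<Gamma>"
  unfolding additive_subgroup_def
proof (intro conjI ballI)
  show "0 \<in> log_\<Gamma>" by (simp add: log_\<Gamma>_def K_simps \<Gamma>_one)
  fix X Y assume XY: "X \<in> log_\<Gamma>" "Y \<in> log_\<Gamma>"
  then have C: "X \<in> \<C>" "Y \<in> \<C>" using log_\<Gamma>_subset_C by auto
  obtain B where B: "B \<in> \<Gamma>" "exp Y * B = 1" using XY(2) \<Gamma>_inverse by (auto simp: log_\<Gamma>_def)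
  have "exp (- Y) * exp Y = 1" using exp_minus_inverse[of "- Y"] by simp
  then have "exp (- Y) = B" 
    by (metis (no_types) B(2) mult.assoc mult.right_neutral mult_1)
  moreover have "exp (X - Y) = exp X * exp (- Y)"
    using exp_add_commuting[of X "- Y"] C_commute[OF C] by simp
  ultimately have "exp (X - Y) \<in> \<Gamma>" using XY(1) B(1) \<Gamma>_mult by (simp add: log_\<Gamma>_def)
  then show "X - Y \<in> log_\<Gamma>" using XY by (simp add: log_\<Gamma>_def K_simps)
qed

lemma D_mult_proj: "D l * proj k = D (\<lambda>j. l k) * proj k"
  unfolding proj_def D_mult[symmetric] by (rule arg_cong[of _ _ D]) auto

lemma D_zero: "D (\<lambda>k. 0) = 0"
  using D_add[of "\<lambda>k. 0" "\<lambda>k. 0"] by simp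

lemma sum_proj: "(\<Sum>k\<in>I. proj k) = 1"
proof -
  have "D (\<lambda>j. \<Sum>k\<in>S. if j = k then 1 else 0) = (\<Sum>k\<in>S. proj k)" if "finite S" for S
    using that
  proof (induction S rule: finite_induct)
    case (insert x S)
    have e: "(\<lambda>j. \<Sum>k\<in>insert x S. if j = k then 1 else 0) =
        (\<lambda>j. (if j = x then 1 else 0) + (\<Sum>k\<in>S. if j = k then 1 else 0 :: complex))"
      by (rule ext) (rule sum.insert[OF insert.hyps])
    show ?case unfolding e D_add insert.IH sum.insert[OF insert.hyps] by (simp only: proj_def)
  qed (simp add: D_zero)
  from this[OF finite_I] have "(\<Sum>k\<in>I. proj k) = D (\<lambda>j. \<Sum>k\<in>I. if j = k then 1 else 0)" by simp
  also have "\<dots> = D (\<lambda>k. 1)" by (rule D_cong) (simp add: finite_I)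
  finally show ?thesis by (simp add: D_one)
qed

lemma sum_proj_apply: "(\<Sum>k\<in>I. proj k \<cdot> x) = x"
  by (simp add: sum_proj flip: endo.sum_left)

text \<open>
  An element \<open>A\<close> of \<open>\<Gamma>\<close> is \<open>D a (1 + M)\<close> with \<open>M\<close> nilpotent; the eigenvalues \<open>a k\<close> are nonzero because
  \<open>A\<close> is invertible.  A logarithm is the sum of the logarithms of the two commuting factors.
\<close>
lemma exp_log_\<Gamma>: "exp ` log_\<Gamma> = \<Gamma>"
proof (intro equalityI subsetI)
  fix A assume A: "A \<in> \<Gamma>"
  then have AK: "A \<in> K" using \<Gamma>_sub by auto
  obtain a N where N: "A = D a + N" "nilpotent N" "N \<in> K"
    by (rule decompositionE[OF AK])
  \<comment> \<open>If \<open>a k = 0\<close>, then \<open>A\<close> acts on the block \<open>k\<close> as the nilpotent \<open>N\<close>.\<close>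
  have a: "a k \<noteq> 0" if k: "k \<in> I" for k
  proof
    assume "a k = 0"
    obtain B where B: "B \<in> \<Gamma>" "A * B = 1" using \<Gamma>_inverse[OF A] by auto
    have BA: "B * A = 1" using \<Gamma>_commute[OF A B(1)] B(2) by simp
    have "D a * B = B * D a" using B(1) \<Gamma>_sub by (intro D_central) auto
    moreover have "N = A - D a" using N(1) by simp
    ultimately have NB: "N * B = B * N"
      by (simp only: left_diff_distrib right_diff_distrib B(2) BA)
    have "nilpotent (N * B)" by (rule nilpotent_mult_commuting[OF N(2) NB])
    moreover have "(N * B) \<cdot> (proj k \<cdot> x) = proj k \<cdot> x" for x
    proof -
      have "A * proj k = N * proj k"
        unfolding N(1) distrib_right D_mult_proj[of a k] by (simp add: \<open>a k = 0\<close> D_zero)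
      then have "B * N * proj k = proj k" using BA by (metis (no_types) mult.assoc mult_1)
      then have "N * B * proj k = proj k" by (simp add: NB)
      then show ?thesis by (metis (no_types) endo_apply_simps(1))
    qed
    ultimately have "proj k \<cdot> x = 0" for x by (rule nilpotent_fixed_point_zero)
    then have "proj k = 0" by (intro endo_eqI) simp
    then show False using D_unit_nonzero[OF k] by (simp add: proj_def)
  qed
  define M where "M = N * D (\<lambda>k. inverse (a k))"
  have NC: "N \<in> \<C>"
  proof -
    have "N = A - D a" using N(1) by simp
    then show ?thesis using \<Gamma>_in_C[OF A] D_in_C by (simp add: C_simps)
  qed
  have "nilpotent M" unfolding M_def
    by (rule nilpotent_mult_commuting[OF N(2) D_central[OF N(3), symmetric]])
  moreover have "M \<in> \<C>" unfolding M_def by (intro C_simps NC D_in_C)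
  ultimately obtain r where r: "r \<in> \<C>" "exp (M * r) = 1 + M"
    using nilpotent_log[OF closed_subalgebra_C, of M] by blast
  define X where "X = D (\<lambda>k. Ln (a k)) + M * r"
  have Mr: "M * r \<in> \<C>" by (intro C_simps r(1) \<open>M \<in> \<C>\<close>)
  have XC: "X \<in> \<C>" unfolding X_def by (intro C_simps D_in_C Mr)
  have "exp X = D (\<lambda>k. exp (Ln (a k))) * (1 + M)"
    unfolding X_def r(2)[symmetric] D_exp[symmetric]
    by (rule exp_add_commuting[OF C_commute[OF D_in_C Mr]])
  also have "D (\<lambda>k. exp (Ln (a k))) = D a" by (rule D_cong) (simp add: a)
  also have "D a * M = N"
  proof -
    have "D a * M = N * (D a * D (\<lambda>k. inverse (a k)))"
      by (simp add: M_def D_central[OF N(3)] flip: mult.assoc)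
    also have "D a * D (\<lambda>k. inverse (a k)) = D (\<lambda>k. 1)"
      unfolding D_mult[symmetric] by (rule D_cong) (simp add: a)
    finally show ?thesis by (simp add: D_one)
  qed
  then have "D a * (1 + M) = A" by (simp add: N(1) distrib_left)
  finally have "exp X = A" .
  then have "X \<in> log_\<Gamma>" using A C_subset_K[OF XC] by (simp add: log_\<Gamma>_def)
  then show "A \<in> exp ` log_\<Gamma>" using \<open>exp X = A\<close> by blast
qed (auto simp: log_\<Gamma>_def)

text \<open>
  On a component \<open>w\<close> of \<open>u\<close> in the block \<open>k\<close>, the equation \<open>exp X w = w\<close> says that \<open>exp N\<close> acts as the
  scalar \<open>exp (- l k)\<close>.  As \<open>exp N\<close> is unipotent, this scalar is \<open>1\<close>, and then \<open>N w = 0\<close>.  So \<open>X\<close>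
  agrees on \<open>u\<close> with some \<open>D m\<close> whose exponential is \<open>1\<close>.
\<close>
lemma stabilizer:
  assumes X: "X \<in> K" and fix_u: "exp X \<cdot> u = u"
  obtains m where "X \<cdot> u = D m \<cdot> u" "\<And>k. exp (m k) = 1"
proof -
  obtain l N where N: "X = D l + N" "nilpotent N" "N \<in> K" "exp X = D (\<lambda>k. exp (l k)) * exp N"
    by (rule decompositionE[OF X])
  have expK: "exp X \<in> K" "exp N \<in> K" using X N(3) closed_subalgebra_exp[OF K] by auto
  have key: "exp (l k) = 1 \<and> N \<cdot> (proj k \<cdot> u) = 0" if nz: "proj k \<cdot> u \<noteq> 0" for k
  proof -
    define w where "w = proj k \<cdot> u"
    define c where "c = exp (l k)"
    have comm: "exp X * proj k = proj k * exp X"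
      unfolding proj_def by (rule D_central[OF expK(1), symmetric])
    have "exp X \<cdot> w = (exp X * proj k) \<cdot> u" by (simp add: w_def)
    also have "\<dots> = w" unfolding comm by (simp add: fix_u w_def)
    finally have fixw: "exp X \<cdot> w = w" .
    have "exp X * proj k = exp N * (D (\<lambda>k. exp (l k)) * proj k)"
      by (simp add: N(4) D_central[OF expK(2)] mult.assoc)
    also have "\<dots> = exp N * D (\<lambda>j. c) * proj k"
      by (simp add: D_mult_proj[of "\<lambda>k. exp (l k)"] c_def mult.assoc)
    finally have "(exp N * D (\<lambda>j. c) * proj k) \<cdot> u = (exp X * proj k) \<cdot> u" by simp
    then have fw: "exp N \<cdot> D (\<lambda>j. c) \<cdot> w = w" using fixw by (simp add: w_def)
    have "c = 1"
    proof (rule ccontr)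
      assume "c \<noteq> 1"
      obtain \<psi> where \<psi>: "exp N = 1 + N + N * N * \<psi>" "\<psi> * N = N * \<psi>" and \<psi>K: "\<psi> \<in> K"
        using exp_second_order_remainder[of N] K N(3) by blast
      note c\<psi> = \<psi>(2)[symmetric]
      \<comment> \<open>Solving \<open>exp N (c w) = w\<close> for \<open>w\<close> gives \<open>w = c / (1 - c) (exp N - 1) w\<close>, where \<open>exp N - 1\<close> is
        a multiple of \<open>N\<close>; so \<open>w\<close> is fixed by a nilpotent operator.\<close>
      define E where "E = D (\<lambda>j. inverse (1 - c) * c)"
      have E: "E * N = N * E" "E * \<psi> = \<psi> * E" unfolding E_def by (auto intro: D_central N \<psi>K)
      define Z where "Z = (1 + N * \<psi>) * E"
      have "N * Z = Z * N" unfolding Z_def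
      proof -
        have "N * ((1 + N * \<psi>) * E) = (N + N * (N * \<psi>)) * E" by (simp add: algebra_simps)
        also have "\<dots> = (N + N * \<psi> * N) * E" by (simp add: c\<psi>[symmetric] mult.assoc)
        also have "\<dots> = (1 + N * \<psi>) * (N * E)" by (simp add: algebra_simps)
        also have "\<dots> = (1 + N * \<psi>) * E * N" by (simp only: E(1)[symmetric] mult.assoc)
        finally show "N * ((1 + N * \<psi>) * E) = (1 + N * \<psi>) * E * N" .
      qed
      then have "nilpotent (N * Z)" by (rule nilpotent_mult_commuting[OF N(2)])
      moreover have "(N * Z) \<cdot> w = w"
      proof -
        define F where "F = D (\<lambda>j. inverse (1 - c))"
        have F: "F * N = N * F" "F * \<psi> = \<psi> * F" unfolding F_def by (auto intro: D_central N \<psi>K)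
        have EF: "E = F * D (\<lambda>j. c)" unfolding E_def F_def D_mult ..
        have "N * Z = F * (N * (1 + N * \<psi>) * D (\<lambda>j. c))"
        proof -
          have "F * N * (1 + N * \<psi>) = N * (1 + N * \<psi>) * F"
          proof -
            have "F * N * (1 + N * \<psi>) = F * N + F * N * N * \<psi>" by (simp add: algebra_simps)
            also have "F * N * N * \<psi> = N * (F * N) * \<psi>" by (simp only: F mult.assoc)
            also have "\<dots> = N * N * (F * \<psi>)" by (simp only: F mult.assoc)
            also have "F * N + N * N * (F * \<psi>) = N * (1 + N * \<psi>) * F"
              by (simp add: F algebra_simps)
            finally show ?thesis .
          qed
          then show ?thesis by (simp add: Z_def EF flip: mult.assoc)
        qed
        also have "N * (1 + N * \<psi>) = exp N - 1" by (simp add: \<psi>(1) algebra_simps)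
        finally have "(N * Z) \<cdot> w = F \<cdot> (exp N \<cdot> D (\<lambda>j. c) \<cdot> w - D (\<lambda>j. c) \<cdot> w)" by simp
        also have "\<dots> = F \<cdot> (w - D (\<lambda>j. c) \<cdot> w)" by (simp only: fw)
        also have "\<dots> = (F * (D (\<lambda>j. 1) - D (\<lambda>j. c))) \<cdot> w" by (simp add: D_one)
        also have "D (\<lambda>j. 1) - D (\<lambda>j. c) = D (\<lambda>j. 1 - c)"
          using D_add[of "\<lambda>j. 1 - c" "\<lambda>j. c"] by simp
        also have "F * D (\<lambda>j. 1 - c) = 1"
          using \<open>c \<noteq> 1\<close> by (simp add: F_def D_one flip: D_mult)
        finally show ?thesis by simp
      qed
      ultimately have "w = 0" by (rule nilpotent_fixed_point_zero)
      then show False using nz by (simp add: w_def)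
    qed
    then have "exp N \<cdot> w = w" using fw by (simp add: D_one)
    then have "N \<cdot> w = 0" by (rule nilpotent_exp_fixed_point[OF N(2)])
    then show ?thesis using \<open>c = 1\<close> by (simp add: c_def w_def)
  qed
  \<comment> \<open>The hypothesis says nothing about \<open>l k\<close> on a block where \<open>u\<close> has no component.\<close>
  define m where "m k = (if proj k \<cdot> u = 0 then 0 else l k)" for k
  have "X \<cdot> (proj k \<cdot> u) = D m \<cdot> (proj k \<cdot> u)" for k
  proof (cases "proj k \<cdot> u = 0")
    case False
    have "(D l * proj k) \<cdot> u = (D m * proj k) \<cdot> u"
      unfolding D_mult_proj[of l k] D_mult_proj[of m k] using False by (simp add: m_def)
    then have "D l \<cdot> (proj k \<cdot> u) = D m \<cdot> (proj k \<cdot> u)" by simp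
    then show ?thesis using key[OF False] by (simp add: N(1))
  qed (simp add: endo.zero_right)
  then have "(\<Sum>k\<in>I. X \<cdot> (proj k \<cdot> u)) = (\<Sum>k\<in>I. D m \<cdot> (proj k \<cdot> u))" by simp
  then have "X \<cdot> u = D m \<cdot> u" by (simp add: sum_proj_apply flip: endo.sum_right)
  moreover have "exp (m k) = 1" for k using key[of k] by (simp add: m_def)
  ultimately show ?thesis by (rule that)
qed

text \<open>
  By the preceding lemma, the component of \<open>X u\<close> in each block is an integer multiple of a fixed
  vector, and there are finitely many blocks.
\<close>
lemma stabilizer_discrete:
  "\<exists>r>0. \<forall>X\<in>K. exp X \<cdot> u = u \<and> norm (X \<cdot> u) < r \<longrightarrow> X \<cdot> u = 0"
proof -
  define v where "v k = D (\<lambda>j. 2 * pi * \<i>) \<cdot> (proj k \<cdot> u)" for k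
  have "\<forall>k\<in>I. \<forall>\<^sub>F r in at_right 0. v k \<noteq> 0 \<longrightarrow> norm (proj k) * r < norm (v k)"
  proof
    fix k
    have "((\<lambda>r. norm (proj k) * r) \<longlongrightarrow> norm (proj k) * 0) (at_right (0::real))"
      by (intro tendsto_intros)
    then show "\<forall>\<^sub>F r in at_right 0. v k \<noteq> 0 \<longrightarrow> norm (proj k) * r < norm (v k)"
      by (cases "v k = 0") (auto dest!: order_tendstoD(2)[of _ _ _ "norm (v k)"])
  qed
  then have "\<forall>\<^sub>F r in at_right (0::real). \<forall>k\<in>I. v k \<noteq> 0 \<longrightarrow> norm (proj k) * r < norm (v k)"
    by (rule eventually_ball_finite[OF finite_I])
  then have "\<forall>\<^sub>F r in at_right (0::real). 0 < r \<and> (\<forall>k\<in>I. v k \<noteq> 0 \<longrightarrow> norm (proj k) * r < norm (v k))"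
    by (intro eventually_conj eventually_at_right_less)
  then obtain r :: real where r: "r > 0" "\<And>k. k \<in> I \<Longrightarrow> v k \<noteq> 0 \<Longrightarrow> norm (proj k) * r < norm (v k)"
    using eventually_happens'[OF trivial_limit_at_right_real] by blast
  have "X \<cdot> u = 0" if X: "X \<in> K" "exp X \<cdot> u = u" "norm (X \<cdot> u) < r" for X
  proof -
    obtain m where m: "X \<cdot> u = D m \<cdot> u" "\<And>k. exp (m k) = 1"
      using stabilizer[OF X(1,2)] by blast
    have "proj k \<cdot> (X \<cdot> u) = 0" if k: "k \<in> I" for k
    proof -
      obtain z :: int where z: "Im (m k) = of_int (2 * z) * pi" "Re (m k) = 0"
        using m(2)[of k] by (auto simp: exp_eq_1)
      then have mk: "m k = of_real (real_of_int z) * (2 * pi * \<i>)" by (simp add: complex_eq_iff)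
      have "proj k * D m = D (\<lambda>j. m k) * proj k"
        using D_central[OF D_in_K] D_mult_proj[of m k] by (simp add: proj_def)
      also have "\<dots> = real_of_int z *\<^sub>R (D (\<lambda>j. 2 * pi * \<i>) * proj k)"
        unfolding mk by (subst D_scaleR) simp
      finally have "(proj k * D m) \<cdot> u = (real_of_int z *\<^sub>R (D (\<lambda>j. 2 * pi * \<i>) * proj k)) \<cdot> u"
        by simp
      then have eq: "proj k \<cdot> (X \<cdot> u) = real_of_int z *\<^sub>R v k"
        by (simp add: m(1) v_def)
      show ?thesis
      proof (rule ccontr)
        assume "proj k \<cdot> (X \<cdot> u) \<noteq> 0"
        then have "v k \<noteq> 0" "z \<noteq> 0" using eq by auto
        then have "1 * norm (v k) \<le> \<bar>real_of_int z\<bar> * norm (v k)" by (intro mult_right_mono) auto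
        also have "\<dots> = norm (proj k \<cdot> (X \<cdot> u))" by (simp add: eq)
        also have "\<dots> \<le> norm (proj k) * norm (X \<cdot> u)" by (rule norm_endo_apply_le)
        also have "\<dots> \<le> norm (proj k) * r" using X(3) by (intro mult_left_mono) auto
        also have "\<dots> < norm (v k)" by (rule r(2)[OF k \<open>v k \<noteq> 0\<close>])
        finally show False by simp
      qed
    qed
    then have "(\<Sum>k\<in>I. proj k \<cdot> (X \<cdot> u)) = 0" by simp
    then show ?thesis by (simp add: sum_proj_apply)
  qed
  with r(1) show ?thesis by blast
qed

lemma exp_orbit: "exp_orbit \<C> log_\<Gamma> u"
proof
  show "subspace \<C>" using closed_subalgebra_C by (simp add: closed_subalgebra_def)
  show "1 \<in> \<C>" by (rule C_simps)
  show "X * Y \<in> \<C>" if "X \<in> \<C>" "Y \<in> \<C>" for X Y using that by (rule C_simps)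
  show "X * Y = Y * X" if "X \<in> \<C>" "Y \<in> \<C>" for X Y using that by (rule C_commute)
  show "log_\<Gamma> \<subseteq> \<C>" by (rule log_\<Gamma>_subset_C)
  show "additive_subgroup log_\<Gamma>" by (rule additive_subgroup_log_\<Gamma>)
  show "\<exists>Y\<in>log_\<Gamma>. X \<cdot> u = Y \<cdot> u" if X: "X \<in> \<C>" "exp X \<cdot> u = u" for X
  proof -
    obtain m where m: "X \<cdot> u = D m \<cdot> u" "\<And>k. exp (m k) = 1"
      using stabilizer[OF C_subset_K[OF X(1)] X(2)] by blast
    have "D m \<in> log_\<Gamma>" by (simp add: log_\<Gamma>_def D_in_K D_exp m(2) D_one \<Gamma>_one)
    with m(1) show ?thesis by blast
  qed
  obtain r where "r > 0" "\<forall>X\<in>K. exp X \<cdot> u = u \<and> norm (X \<cdot> u) < r \<longrightarrow> X \<cdot> u = 0"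
    using stabilizer_discrete by blast
  then show "\<exists>r>0. \<forall>X\<in>\<C>. exp X \<cdot> u = u \<and> norm (X \<cdot> u) < r \<longrightarrow> X \<cdot> u = 0"
    using C_subset_K by (intro exI[of _ r]) simp
qed

lemma orbit_locally_manifold:
  "\<exists>Q. open Q \<and> u \<in> Q \<and> manifold_of_dim (closed_subgroup_dim (closure ((\<lambda>X. X \<cdot> u) ` log_\<Gamma>)))
     (closure ((\<lambda>A. A \<cdot> u) ` \<Gamma>) \<inter> Q)"
proof -
  interpret exp_orbit \<C> log_\<Gamma> u by (rule exp_orbit)
  have "(\<lambda>A. A \<cdot> u) ` exp ` log_\<Gamma> = expH_u"
    unfolding expH_u_def by (rule image_image)
  then have "expH_u = (\<lambda>A. A \<cdot> u) ` \<Gamma>" by (simp only: exp_log_\<Gamma>)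
  with locally_manifold show ?thesis by (simp add: Hu_def)
qed

end

section \<open>Matrices as endomorphisms\<close>

definition endo_of :: "complex ^ 'n ^ 'n \<Rightarrow> (complex ^ 'n) endo" where
  "endo_of A = Abs_endo (Blinfun ((*v) A))"

definition matrix_of :: "(complex ^ 'n) endo \<Rightarrow> complex ^ 'n ^ 'n" where
  "matrix_of T = (\<chi> i j. (T \<cdot> axis j 1) $ i)"

lemma endo_of_apply [simp]: "endo_of A \<cdot> x = A *v x"
  unfolding endo_of_def endo_apply.rep_eq
  by (simp add: Abs_endo_inverse bounded_linear_Blinfun_apply)

lemma scaleR_matrix_vector: "(c *\<^sub>R A) *v x = c *\<^sub>R (A *v x)" "A *v (c *\<^sub>R x) = c *\<^sub>R (A *v x)"
  for A :: "complex ^ 'n ^ 'm"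
  by (simp_all add: vec_eq_iff matrix_vector_mult_def scaleR_sum_right)

lemma matrix_mult_scaleR:
  fixes A B :: "complex ^ 'n ^ 'n"
  shows "A ** (c *\<^sub>R B) = c *\<^sub>R (A ** B)" "(c *\<^sub>R A) ** B = c *\<^sub>R (A ** B)"
  by (simp_all add: vec_eq_iff matrix_matrix_mult_def scaleR_sum_right)

lemma endo_of_simps:
  "endo_of (A ** B) = endo_of A * endo_of B" "endo_of (mat 1) = 1"
  by (rule endo_eqI; simp add: matrix_vector_mul_assoc)+

lemma matrix_of_endo_of [simp]: "matrix_of (endo_of A) = A"
  by (simp add: matrix_of_def vec_eq_iff matrix_vector_mult_def axis_def if_distrib cong: if_cong)

lemma endo_of_inject: "endo_of A = endo_of B \<longleftrightarrow> A = B"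
  by (metis matrix_of_endo_of)

lemma bounded_linear_endo_of: "bounded_linear endo_of"
  unfolding linear_conv_bounded_linear[symmetric]
  by (rule linearI; rule endo_eqI)
     (simp_all add: matrix_vector_mult_add_rdistrib scaleR_matrix_vector)

lemma bounded_linear_matrix_of: "bounded_linear (matrix_of :: (complex ^ 'n) endo \<Rightarrow> _)"
proof (rule bounded_linear_intro)
  fix S T :: "(complex ^ 'n) endo" and c :: real
  show "matrix_of (S + T) = matrix_of S + matrix_of T" "matrix_of (c *\<^sub>R T) = c *\<^sub>R matrix_of T"
    by (simp_all add: matrix_of_def vec_eq_iff)
  have le: "norm x \<le> (\<Sum>i\<in>UNIV. norm (x $ i))" for x :: "'b::real_normed_vector ^ 'n"
    unfolding norm_vec_def by (rule L2_set_le_sum) simp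
  have entry: "norm (matrix_of T $ i $ j) \<le> norm T" for i j
  proof -
    have "norm (matrix_of T $ i $ j) \<le> norm (T \<cdot> axis j 1)"
      unfolding matrix_of_def by (simp add: Finite_Cartesian_Product.norm_nth_le)
    also have "\<dots> \<le> norm T * norm (axis j (1::complex))" by (rule norm_endo_apply_le)
    finally show ?thesis by (simp add: norm_Basis axis_in_Basis_iff Basis_complex_def)
  qed
  have "norm (matrix_of T) \<le> (\<Sum>i\<in>UNIV. norm (matrix_of T $ i))" by (rule le)
  also have "\<dots> \<le> (\<Sum>i\<in>(UNIV::'n set). \<Sum>j\<in>(UNIV::'n set). norm (matrix_of T $ i $ j))"
    by (intro sum_mono le)
  also have "\<dots> \<le> (\<Sum>i\<in>(UNIV::'n set). \<Sum>j\<in>(UNIV::'n set). norm T)"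
    by (intro sum_mono entry)
  also have "\<dots> = norm T * (real CARD('n) * real CARD('n))" by simp
  finally show "norm (matrix_of T) \<le> norm T * (real CARD('n) * real CARD('n))" .
qed

text \<open>
  The exponential series converges in the algebra of endomorphisms; its image under the continuous
  map \<open>matrix_of\<close> is the series that defines \<^const>\<open>matrix_exp\<close>.
\<close>
lemma endo_of_matrix_exp: "endo_of (matrix_exp A) = exp (endo_of A)"
proof -
  have pow: "endo_of (matrix_power A k) = endo_of A ^ k" for k
    by (induction k) (simp_all add: matrix_power_def endo_of_simps)
  have "(\<lambda>k. matrix_of (endo_of A ^ k /\<^sub>R fact k)) sums matrix_of (exp (endo_of A))"
    by (rule bounded_linear.sums[OF bounded_linear_matrix_of exp_converges])
  moreover have "matrix_of (endo_of A ^ k /\<^sub>R fact k) = (1 / fact k) *\<^sub>R matrix_power A k" for k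
    by (simp add: linear_scale[OF bounded_linear.linear[OF bounded_linear_matrix_of]]
        inverse_eq_divide flip: pow)
  ultimately have s: "(\<lambda>k. (1 / fact k) *\<^sub>R matrix_power A k) sums matrix_of (exp (endo_of A))"
    by simp
  then have "(\<lambda>k. endo_of ((1 / fact k) *\<^sub>R matrix_power A k)) sums endo_of (matrix_exp A)"
    unfolding matrix_exp_def
    by (intro bounded_linear.sums[OF bounded_linear_endo_of] summable_sums sums_summable)
  moreover have "endo_of ((1 / fact k) *\<^sub>R matrix_power A k) = endo_of A ^ k /\<^sub>R fact k" for k
    by (simp add: linear_scale[OF bounded_linear.linear[OF bounded_linear_endo_of]]
        inverse_eq_divide pow)
  ultimately have "(\<lambda>k. endo_of A ^ k /\<^sub>R fact k) sums endo_of (matrix_exp A)" by simp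
  then show ?thesis by (rule sums_unique2[OF _ exp_converges])
qed

section \<open>Block diagonal triangular matrices\<close>

lemma K_algI:
  assumes "\<And>i j. block \<eta> i \<noteq> block \<eta> j \<Longrightarrow> A $ i $ j = 0"
    and "\<And>i j. block \<eta> i = block \<eta> j \<Longrightarrow> i < j \<Longrightarrow> A $ i $ j = 0"
    and "\<And>i j. block \<eta> i = block \<eta> j \<Longrightarrow> A $ i $ i = A $ j $ j"
  shows "A \<in> K_alg \<eta>"
  using assms unfolding K_alg_def by blast

lemma K_algD:
  assumes "A \<in> K_alg \<eta>"
  shows "block \<eta> i \<noteq> block \<eta> j \<Longrightarrow> A $ i $ j = 0"
    and "i < j \<Longrightarrow> A $ i $ j = 0"
    and "block \<eta> i = block \<eta> j \<Longrightarrow> A $ i $ i = A $ j $ j"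
  using assms unfolding K_alg_def by blast+

lemma subspace_K_alg: "subspace (K_alg \<eta> :: (complex ^ 'n::{finite,linorder} ^ 'n::{finite,linorder}) set)"
  unfolding subspace_def
proof (intro conjI ballI allI)
  show "0 \<in> K_alg \<eta>" by (rule K_algI) simp_all
  fix A B :: "complex ^ 'n::{finite,linorder} ^ 'n::{finite,linorder}" assume "A \<in> K_alg \<eta>" "B \<in> K_alg \<eta>"
  note AB = this
  show "A + B \<in> K_alg \<eta>"
  proof (rule K_algI)
    show "(A + B) $ i $ i = (A + B) $ j $ j" if "block \<eta> i = block \<eta> j" for i j
      using AB[THEN K_algD(3), OF that] by simp
  qed (use AB[THEN K_algD(1)] AB[THEN K_algD(2)] in simp_all)
next
  fix c :: real and A :: "complex ^ 'n::{finite,linorder} ^ 'n::{finite,linorder}" assume "A \<in> K_alg \<eta>"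
  note A = this
  show "c *\<^sub>R A \<in> K_alg \<eta>"
  proof (rule K_algI)
    show "(c *\<^sub>R A) $ i $ i = (c *\<^sub>R A) $ j $ j" if "block \<eta> i = block \<eta> j" for i j
      using K_algD(3)[OF A that] by simp
  qed (use K_algD(1)[OF A] K_algD(2)[OF A] in simp_all)
qed

lemma K_alg_mult:
  assumes A: "A \<in> K_alg \<eta>" and B: "B \<in> K_alg \<eta>"
  shows "A ** B \<in> K_alg \<eta>"
proof (rule K_algI)
  have e: "(A ** B) $ i $ j = (\<Sum>k\<in>UNIV. A $ i $ k * B $ k $ j)" for i j
    by (simp add: matrix_matrix_mult_def)
  show "(A ** B) $ i $ j = 0" if "block \<eta> i \<noteq> block \<eta> j" for i j
  proof -
    have "A $ i $ k * B $ k $ j = 0" for k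
      using that K_algD(1)[OF A, of i k] K_algD(1)[OF B, of k j]
      by (cases "block \<eta> i = block \<eta> k") simp_all
    then show ?thesis by (simp only: e sum.neutral_const)
  qed
  show "(A ** B) $ i $ j = 0" if "i < j" for i j
  proof -
    have "A $ i $ k * B $ k $ j = 0" for k
      using that K_algD(2)[OF A, of i k] K_algD(2)[OF B, of k j]
      by (cases "i < k") (simp_all add: not_less le_less_trans)
    then show ?thesis by (simp only: e sum.neutral_const)
  qed
  have d: "(A ** B) $ i $ i = A $ i $ i * B $ i $ i" for i
  proof -
    have "A $ i $ k * B $ k $ i = (if k = i then A $ i $ i * B $ i $ i else 0)" for k
      using K_algD(2)[OF A, of i k] K_algD(2)[OF B, of k i] by (cases k i rule: linorder_cases) auto
    then have "(\<Sum>k\<in>UNIV. A $ i $ k * B $ k $ i) = (\<Sum>k\<in>UNIV. if k = i then A $ i $ i * B $ i $ i else 0)"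
      by (rule sum.cong[OF refl])
    then show ?thesis by (simp only: e) simp
  qed
  show "(A ** B) $ i $ i = (A ** B) $ j $ j" if "block \<eta> i = block \<eta> j" for i j
    unfolding d using K_algD(3)[OF A that] K_algD(3)[OF B that] by simp
qed

definition block_scalar :: "nat list \<Rightarrow> (nat \<Rightarrow> complex) \<Rightarrow> complex ^ 'n::{finite,linorder} ^ 'n::{finite,linorder}" where
  "block_scalar \<eta> l = (\<chi> i j. if i = j then l (block \<eta> i) else 0)"

lemma block_scalar_in_K_alg: "block_scalar \<eta> l \<in> K_alg \<eta>"
  by (rule K_algI) (auto simp: block_scalar_def)

lemma block_scalar_mult:
  fixes A :: "complex ^ 'n::{finite,linorder} ^ 'n::{finite,linorder}"
  shows "(block_scalar \<eta> l ** A) $ i $ j = l (block \<eta> i) * A $ i $ j"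
    "(A ** block_scalar \<eta> l) $ i $ j = A $ i $ j * l (block \<eta> j)"
  by (simp_all add: matrix_matrix_mult_def block_scalar_def if_distrib if_distribR cong: if_cong)

lemma block_scalar_central:
  assumes "A \<in> K_alg \<eta>"
  shows "block_scalar \<eta> l ** A = A ** block_scalar \<eta> l"
proof -
  have "(block_scalar \<eta> l ** A) $ i $ j = (A ** block_scalar \<eta> l) $ i $ j" for i j
    using K_algD(1)[OF assms, of i j] by (cases "block \<eta> i = block \<eta> j") (simp_all add: block_scalar_mult)
  then show ?thesis by (simp add: vec_eq_iff)
qed

lemma pos_mono: "j < i \<Longrightarrow> pos j < pos i"
  unfolding pos_def by (intro psubset_card_mono) auto

text \<open>
  A nonzero entry of the \<open>k\<close>-th power comes from a strictly descending chain of \<open>k + 1\<close> indices,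
  so its row has at least \<open>k\<close> predecessors.
\<close>
lemma strictly_lower_triangular_power:
  fixes N :: "complex ^ 'n::{finite,linorder} ^ 'n::{finite,linorder}"
  assumes N: "\<And>i j. N $ i $ j \<noteq> 0 \<Longrightarrow> j < i"
  shows "matrix_power N (CARD('n)) = 0"
proof -
  have lb: "k \<le> pos i" if "matrix_power N k $ i $ j \<noteq> 0" for k i j
    using that
  proof (induction k arbitrary: i)
    case (Suc k)
    have "(\<Sum>l\<in>UNIV. N $ i $ l * matrix_power N k $ l $ j) \<noteq> 0"
      using Suc.prems by (simp add: matrix_power_def matrix_matrix_mult_def)
    then obtain l where "N $ i $ l * matrix_power N k $ l $ j \<noteq> 0"
      by (meson sum.not_neutral_contains_not_neutral)
    then have "l < i" "k \<le> pos l" using N Suc.IH by auto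
    then show ?case using pos_mono[of l i] by simp
  qed simp
  have "pos i < CARD('n)" for i :: 'n
    unfolding pos_def by (intro psubset_card_mono) auto
  then show ?thesis using lb by (metis (no_types, lifting) not_le vec_eq_iff zero_index)
qed

lemma block_scalar_exp_sums:
  "(\<lambda>k. block_scalar \<eta> (\<lambda>b. l b ^ k /\<^sub>R fact k)) sums
     (block_scalar \<eta> (\<lambda>b. exp (l b)) :: complex ^ 'n::{finite,linorder} ^ 'n::{finite,linorder})"
  unfolding sums_def
proof (intro vec_tendstoI)
  fix i j :: 'n
  have "(\<lambda>k. l (block \<eta> i) ^ k /\<^sub>R fact k) sums exp (l (block \<eta> i))" by (rule exp_converges)
  then show "(\<lambda>n. (\<Sum>k<n. block_scalar \<eta> (\<lambda>b. l b ^ k /\<^sub>R fact k)) $ i $ j)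
      \<longlonglongrightarrow> block_scalar \<eta> (\<lambda>b. exp (l b)) $ i $ j"
    by (cases "i = j") (simp_all add: block_scalar_def sums_def)
qed

section \<open>Groups in normal form\<close>

lemma block_algebra_normal_form:
  fixes G :: "(complex ^ 'n::{finite,linorder} ^ 'n::{finite,linorder}) set"
  assumes G: "abelian_subgroup_GL G" and nf: "normal_form G \<eta> P"
  defines "\<kappa> \<equiv> \<lambda>A. endo_of (P ** A ** matrix_inv P)"
  shows "block_algebra (\<kappa> ` K_alg \<eta>) (\<lambda>l. \<kappa> (block_scalar \<eta> l)) (range (block \<eta> :: 'n \<Rightarrow> nat)) (endo_of ` G)"
proof -
  let ?K = "K_alg \<eta> :: (((complex, 'n) vec, 'n) vec) set"
  have P: "P ** matrix_inv P = mat 1" "matrix_inv P ** P = mat 1"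
    using nf matrix_inv_invertible by (auto simp: normal_form_def)
  have k_apply: "\<kappa> A \<cdot> x = P *v (A *v (matrix_inv P *v x))" for A x
    by (simp add: \<kappa>_def matrix_vector_mul_assoc matrix_mul_assoc)
  have P_apply: "matrix_inv P *v (P *v x) = x" "P *v (matrix_inv P *v x) = x" for x
    by (simp_all add: matrix_vector_mul_assoc P)
  have k_mult: "\<kappa> (A ** B) = \<kappa> A * \<kappa> B" for A B
    by (rule endo_eqI) (simp add: k_apply P_apply flip: matrix_vector_mul_assoc)
  have k_one: "\<kappa> (mat 1) = 1" by (rule endo_eqI) (simp add: k_apply P_apply)
  have k_add: "\<kappa> (A + B) = \<kappa> A + \<kappa> B" for A B
    by (rule endo_eqI) (simp add: k_apply matrix_vector_mult_add_rdistrib matrix_vector_right_distrib)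
  have k_scale: "\<kappa> (c *\<^sub>R A) = c *\<^sub>R \<kappa> A" for c A
    by (rule endo_eqI) (simp add: k_apply scaleR_matrix_vector)
  have k_linear: "linear \<kappa>" by (intro linearI k_add k_scale)
  then have k_bounded: "bounded_linear \<kappa>" by (simp add: linear_conv_bounded_linear)
  define kinv where "kinv T = matrix_inv P ** matrix_of T ** P" for T
  have conj: "matrix_inv P ** (P ** A ** matrix_inv P) ** P = A"
    "P ** (matrix_inv P ** A ** P) ** matrix_inv P = A" for A :: "((complex, 'n) vec, 'n) vec"
  proof -
    have "matrix_inv P ** (P ** A ** matrix_inv P) ** P = matrix_inv P ** P ** A ** (matrix_inv P ** P)"
      "P ** (matrix_inv P ** A ** P) ** matrix_inv P = P ** matrix_inv P ** A ** (P ** matrix_inv P)"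
      by (simp_all only: matrix_mul_assoc)
    then show "matrix_inv P ** (P ** A ** matrix_inv P) ** P = A"
      "P ** (matrix_inv P ** A ** P) ** matrix_inv P = A" by (simp_all add: P)
  qed
  have kinv_k: "kinv (\<kappa> A) = A" for A by (simp add: kinv_def \<kappa>_def conj)
  have k_inject: "\<kappa> A = \<kappa> B \<longleftrightarrow> A = B" for A B by (metis kinv_k)
  have kinv_cont: "continuous_on UNIV kinv"
  proof -
    have "linear (\<lambda>B :: ((complex, 'n) vec, 'n) vec. matrix_inv P ** B ** P)"
      by (rule linearI)
         (simp_all add: matrix_add_ldistrib matrix_mult_add_left matrix_mult_scaleR)
    then have "bounded_linear (\<lambda>B :: ((complex, 'n) vec, 'n) vec. matrix_inv P ** B ** P)"
      by (simp add: linear_conv_bounded_linear)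
    then have "bounded_linear kinv"
      unfolding kinv_def[abs_def] by (rule bounded_linear_compose[OF _ bounded_linear_matrix_of])
    then show ?thesis by (rule linear_continuous_on)
  qed
  have K_eq: "\<kappa> ` ?K = {T. \<kappa> (kinv T) = T} \<inter> kinv -` ?K"
    by (auto simp: kinv_k intro: rev_image_eqI)
  have closed_K: "closed (\<kappa> ` ?K)"
    unfolding K_eq
  proof (intro closed_Int closed_vimage closed_Collect_eq kinv_cont continuous_on_id closed_subspace subspace_K_alg)
    show "continuous_on UNIV (\<lambda>T. \<kappa> (kinv T))"
      by (intro continuous_on_compose2[OF linear_continuous_on[OF k_bounded, of UNIV] kinv_cont]) simp
  qed
  have one_K: "mat 1 \<in> ?K" by (rule K_algI) (auto simp: mat_def)
  have inv_G: "A \<in> G \<Longrightarrow> matrix_inv P ** A ** P \<in> ?K" for A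
    using nf by (auto simp: normal_form_def K_star_def)
  note G' = abelian_subgroup_GL_simps[OF G]
  show ?thesis
  proof
    show "closed_subalgebra (\<kappa> ` ?K)"
      unfolding closed_subalgebra_def
    proof (intro conjI ballI closed_K)
      show "subspace (\<kappa> ` ?K)" by (rule linear_subspace_image[OF k_linear subspace_K_alg])
      show "1 \<in> \<kappa> ` ?K" using one_K k_one by (metis imageI)
      show "a * b \<in> \<kappa> ` ?K" if "a \<in> \<kappa> ` ?K" "b \<in> \<kappa> ` ?K" for a b
        using that by (auto simp flip: k_mult intro: K_alg_mult)
    qed
    fix l m :: "nat \<Rightarrow> complex"
    show "\<kappa> (block_scalar \<eta> l) \<in> \<kappa> ` ?K" by (intro imageI block_scalar_in_K_alg)
    show "\<kappa> (block_scalar \<eta> l) * X = X * \<kappa> (block_scalar \<eta> l)" if X: "X \<in> \<kappa> ` ?K" for X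
    proof -
      obtain A where "A \<in> ?K" "X = \<kappa> A" using X by blast
      then show ?thesis by (simp add: block_scalar_central flip: k_mult)
    qed
    show "\<kappa> (block_scalar \<eta> (\<lambda>k. l k + m k)) = \<kappa> (block_scalar \<eta> l) + \<kappa> (block_scalar \<eta> m)"
      unfolding k_add[symmetric] k_inject by (simp add: block_scalar_def vec_eq_iff)
    show mult: "\<kappa> (block_scalar \<eta> (\<lambda>k. l k * m k)) = \<kappa> (block_scalar \<eta> l) * \<kappa> (block_scalar \<eta> m)" for l m
      unfolding k_mult[symmetric] k_inject
      by (simp add: vec_eq_iff block_scalar_mult) (simp add: block_scalar_def)
    show scale: "\<kappa> (block_scalar \<eta> (\<lambda>k. of_real r * l k)) = r *\<^sub>R \<kappa> (block_scalar \<eta> l)" for r l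
      unfolding k_scale[symmetric] k_inject
      by (simp add: block_scalar_def vec_eq_iff scaleR_conv_of_real[where 'a = complex])
    have bs_one: "block_scalar \<eta> (\<lambda>k. 1) = (mat 1 :: ((complex, 'n) vec, 'n) vec)"
      by (simp add: block_scalar_def mat_def)
    show one: "\<kappa> (block_scalar \<eta> (\<lambda>k. 1)) = 1" by (simp add: bs_one k_one)
    show "exp (\<kappa> (block_scalar \<eta> l)) = \<kappa> (block_scalar \<eta> (\<lambda>k. exp (l k)))"
    proof (rule sums_unique2[OF exp_converges])
      have pow: "\<kappa> (block_scalar \<eta> (\<lambda>b. l b ^ k)) = \<kappa> (block_scalar \<eta> l) ^ k" for k
        by (induction k) (simp_all add: one mult)
      have summand: "\<kappa> (block_scalar \<eta> (\<lambda>b. l b ^ k /\<^sub>R fact k)) = \<kappa> (block_scalar \<eta> l) ^ k /\<^sub>R fact k" for k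
        unfolding pow[symmetric] scale[symmetric] by (simp add: scaleR_conv_of_real[where 'a = complex])
      show "(\<lambda>k. \<kappa> (block_scalar \<eta> l) ^ k /\<^sub>R fact k) sums \<kappa> (block_scalar \<eta> (\<lambda>k. exp (l k)))"
        unfolding summand[symmetric] by (rule bounded_linear.sums[OF k_bounded block_scalar_exp_sums])
    qed
    show "\<kappa> (block_scalar \<eta> l) = \<kappa> (block_scalar \<eta> m)"
      if "\<And>k. k \<in> range (block \<eta> :: 'n \<Rightarrow> nat) \<Longrightarrow> l k = m k"
      unfolding k_inject by (simp add: block_scalar_def vec_eq_iff that)
    show "finite (range (block \<eta> :: 'n \<Rightarrow> nat))" by simp
    show "\<kappa> (block_scalar \<eta> (\<lambda>j. if j = k then 1 else 0)) \<noteq> 0"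
      if k: "k \<in> range (block \<eta> :: 'n \<Rightarrow> nat)" for k
    proof
      obtain i :: 'n where i: "k = block \<eta> i" using k by blast
      assume "\<kappa> (block_scalar \<eta> (\<lambda>j. if j = k then 1 else 0)) = 0"
      then have "block_scalar \<eta> (\<lambda>j. if j = k then 1 else 0) = (0 :: ((complex, 'n) vec, 'n) vec)"
        using linear_0[OF k_linear] k_inject by metis
      then have "block_scalar \<eta> (\<lambda>j. if j = k then 1 else 0) $ i $ i = (0 :: ((complex, 'n) vec, 'n) vec) $ i $ i"
        by simp
      then show False by (simp add: block_scalar_def i)
    qed
    show "\<exists>l N. X = \<kappa> (block_scalar \<eta> l) + N \<and> nilpotent N" if X: "X \<in> \<kappa> ` ?K" for X
    proof -
      obtain A where A: "A \<in> ?K" "X = \<kappa> A" using X by blast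
      define l where "l b = A $ (SOME i. block \<eta> i = b) $ (SOME i. block \<eta> i = b)" for b
      have l: "l (block \<eta> i) = A $ i $ i" for i
        unfolding l_def by (rule K_algD(3)[OF A(1)]) (rule someI[of _ i], rule refl)
      define N where "N = A - block_scalar \<eta> l"
      have "j < i" if "N $ i $ j \<noteq> 0" for i j
        using that K_algD(2)[OF A(1), of i j]
        by (cases i j rule: linorder_cases) (auto simp: N_def block_scalar_def l split: if_splits)
      then have "matrix_power N (CARD('n)) = 0" by (rule strictly_lower_triangular_power)
      moreover have "\<kappa> (matrix_power N k) = \<kappa> N ^ k" for k
        by (induction k) (simp_all add: matrix_power_def k_one k_mult)
      ultimately have "\<kappa> N ^ CARD('n) = 0" using linear_0[OF k_linear] by metis
      then have "nilpotent (\<kappa> N)" by (auto simp: nilpotent_def)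
      moreover have "X = \<kappa> (block_scalar \<eta> l) + \<kappa> N"
        unfolding A(2) k_add[symmetric] by (simp add: N_def)
      ultimately show ?thesis by blast
    qed
    show "endo_of ` G \<subseteq> \<kappa> ` ?K"
    proof
      fix T assume "T \<in> endo_of ` G"
      then obtain A where A: "A \<in> G" "T = endo_of A" by blast
      have "T = \<kappa> (matrix_inv P ** A ** P)" by (simp add: A(2) \<kappa>_def conj)
      then show "T \<in> \<kappa> ` ?K" using inv_G[OF A(1)] by blast
    qed
    show "1 \<in> endo_of ` G" using G'(1) endo_of_simps(2) by (metis imageI)
    show "A * B \<in> endo_of ` G" if "A \<in> endo_of ` G" "B \<in> endo_of ` G" for A B
      using that by (auto simp: G'(3) simp flip: endo_of_simps)
    show "A * B = B * A" if "A \<in> endo_of ` G" "B \<in> endo_of ` G" for A B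
      using that by (auto simp: G'(5) endo_of_inject simp flip: endo_of_simps)
    show "\<exists>B\<in>endo_of ` G. A * B = 1" if "A \<in> endo_of ` G" for A
    proof -
      obtain B where B: "B \<in> G" "A = endo_of B" using \<open>A \<in> endo_of ` G\<close> by blast
      then have "A * endo_of (matrix_inv B) = 1"
        by (simp add: G'(6) endo_of_simps(2) flip: endo_of_simps(1))
      then show ?thesis using G'(4)[OF B(1)] by blast
    qed
  qed
qed

lemma closure_orbit_locally_manifold:
  fixes G :: "(complex ^ 'n::{finite,linorder} ^ 'n::{finite,linorder}) set"
  assumes G: "abelian_subgroup_GL G" and nf: "normal_form G \<eta> P"
  shows "\<exists>Q. open Q \<and> u \<in> Q \<and>
    manifold_of_dim (closed_subgroup_dim (closure (g_at G \<eta> P u))) (closure (orbit G u) \<inter> Q)"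
proof -
  define \<kappa> where "\<kappa> A = endo_of (P ** A ** matrix_inv P)" for A
  interpret block_algebra "\<kappa> ` K_alg \<eta>" "\<lambda>l. \<kappa> (block_scalar \<eta> l)" "range (block \<eta> :: 'n \<Rightarrow> nat)" "endo_of ` G"
    unfolding \<kappa>_def by (rule block_algebra_normal_form[OF G nf])
  have "(\<lambda>A. A \<cdot> u) ` endo_of ` G = orbit G u" by (auto simp: orbit_def image_image)
  moreover have "log_\<Gamma> = endo_of ` g_set G \<eta> P"
    unfolding log_\<Gamma>_def g_set_def \<kappa>_def
    by (auto simp: endo_of_inject simp flip: endo_of_matrix_exp)
  then have "(\<lambda>X. X \<cdot> u) ` log_\<Gamma> = g_at G \<eta> P u" by (auto simp: g_at_def image_image)
  ultimately show ?thesis using orbit_locally_manifold[of u] by simp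
qed

theorem theorem1p2:
  fixes G :: "(complex ^ 'n::{finite,linorder} ^ 'n::{finite,linorder}) set"
    and u :: "complex ^ 'n::{finite,linorder}"
    and m :: nat
  assumes "abelian_subgroup_GL G"
  shows "(regular_with_order m (orbit G u) \<longleftrightarrow>
            (\<forall>v\<in>U_set G u. regular_with_order m (orbit G v))) \<and>
         (\<forall>\<eta> P. normal_form G \<eta> P \<longrightarrow>
            (regular_with_order m (orbit G u) \<longleftrightarrow>
               closed_subgroup_dim (closure (g_at G \<eta> P u)) = m))"
proof (intro conjI allI impI regular_orbit_iff_U_set[OF assms])
  fix \<eta> P assume nf: "normal_form G \<eta> P"
  let ?d = "closed_subgroup_dim (closure (g_at G \<eta> P u))" and ?X = "closure (orbit G u)"
  obtain Q where Q: "open Q" "u \<in> Q" "manifold_of_dim ?d (?X \<inter> Q)"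
    using closure_orbit_locally_manifold[OF assms nf] by blast
  have "u \<in> ?X" using self_in_orbit[OF assms] closure_subset by blast
  show "regular_with_order m (orbit G u) \<longleftrightarrow> ?d = m"
  proof
    assume "regular_with_order m (orbit G u)"
    then obtain R where R: "open R" "u \<in> R" "manifold_of_dim m (?X \<inter> R)"
      using regular_orbit_iff_local[OF assms] by blast
    show "?d = m"
      by (rule manifold_dim_unique[OF Q(3) _ _ R(3), where X = ?X and x = u])
         (use Q R \<open>u \<in> ?X\<close> in \<open>auto simp: openin_open_Int\<close>)
  next
    assume "?d = m"
    then show "regular_with_order m (orbit G u)"
      using Q regular_orbit_iff_local[OF assms] by blast
  qed
qed

end
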